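(* Let $A$ be a cocommutative Hopf algebra over a field $k$ and let $M$ be an $A$-bimodule. Then for each $n \ge 0$ there is an isomorphism of $k$-vector spaces $$\mathrm{HHS}^{n}(A,M) \cong \mathrm{HS}^{n}(A,{}^{\mathrm{ad}}M),$$ where $\mathrm{HHS}^{\bullet}(A,M)$ is the symmetric Hochschild cohomology of $A$ with coefficients in $M$, $\mathrm{HS}^{\bullet}(A,{}^{\mathrm{ad}}M)$ is the symmetric cohomology of $A$ with coefficients in ${}^{\mathrm{ad}}M$, and ${}^{\mathrm{ad}}M$ is $M$ regarded as a left $A$-module via the left adjoint action.
   Context: Throughout, $k$ is a field, $\otimes=\otimes_k$, and $A$ is a Hopf algebra over $k$ with coproduct $\Delta$, counit $\varepsilon$ and antipode $S$. Sweedler notation $\Delta(a)=a^{(1)}\otimes a^{(2)}$ (summation suppressed) is used, and similarly for iterated coproducts. $A$ is cocommutative if $a^{(1)}\otimes a^{(2)}=a^{(2)}\otimes a^{(1)}$ for all $a\in A$. $A^{\mathrm e}=A\otimes A^{\mathrm{op}}$. Left adjoint action: for an $A$-bimodule $M$, ${}^{\mathrm{ad}}M$ is the $k$-space $M$ with left $A$-action $a\cdot m=a^{(1)}mS(a^{(2)})$. The symmetric group $S_{n+1}$ is generated by the transpositions $\sigma_i=(i,i+1)$, $1\le i\le n$. Symmetric cohomology: for a left $A$-module $N$ and $n\ge 0$, let $T_n(A)=A^{\otimes n+1}$ with left $A$-action $b\cdot(a_0\otimes a_1\otimes\cdots\otimes a_n)=ba_0\otimes a_1\otimes\cdots\otimes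 a_n$, and for $n\ge1$ let $d_n:T_n(A)\to T_{n-1}(A)$, $$d_n(a_0\otimes\cdots\otimes a_n)=\sum_{i=0}^{n-1}(-1)^i a_0\otimes\cdots\otimes a_ia_{i+1}\otimes\cdots\otimes a_n+(-1)^n a_0\otimes\cdots\otimes a_{n-1}\varepsilon(a_n).$$ Let $C^n(A,N)=\mathrm{Hom}_A(T_n(A),N)$ with differential $f\mapsto f\circ d_{n+1}$. For $A$ cocommutative, $S_{n+1}$ acts on $C^n(A,N)$ by $$(\sigma_if)(a_0\otimes\cdots\otimes a_n)=-f(a_0\otimes\cdots\otimes a_{i-1}a_i^{(1)}\otimes S(a_i^{(2)})\otimes a_i^{(3)}a_{i+1}\otimes\cdots\otimes a_n)\quad(1\le i\le n-1),$$ $$(\sigma_nf)(a_0\otimes\cdots\otimes a_n)=-f(a_0\otimes\cdots\otimes a_{n-1}a_n^{(1)}\otimes S(a_n^{(2)})).$$ The invariants $CS^n(A,N)=C^n(A,N)^{S_{n+1}}$ form a subcomplex, and $\mathrm{HS}^n(A,N)=\mathrm H^n(CS^\bullet(A,N))$. Symmetric Hochschild cohomology: for an $A$-bimodule $M$ and $n\ge0$, let $T^{\mathrm e}_n(A)=A^{\otimes n+2}$ with bimodule structure $b\cdot(a_0\otimes\cdots\otimes a_{n+1})\cdot c=ba_0\otimes a_1\otimes\cdots\otimes a_n\otimes a_{n+1}c$, and for $n\ge 1$ let $d^{\mathrm e}_n:T^{\mathrm e}_n(A)\to T^{\mathrm e}_{n-1}(A)$, $$d^{\mathrm e}_n(a_0\otimes\cdots\otimes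 a_{n+1})=\sum_{i=0}^n(-1)^ia_0\otimes\cdots\otimes a_ia_{i+1}\otimes\cdots\otimes a_{n+1}.$$ Let $C_{\mathrm e}^n(A,M)=\mathrm{Hom}_{A^{\mathrm e}}(T^{\mathrm e}_n(A),M)$ with differential $f\mapsto f\circ d^{\mathrm e}_{n+1}$. For $A$ cocommutative, $S_{n+1}$ acts on $C_{\mathrm e}^n(A,M)$ by $$(\sigma_if)(a_0\otimes\cdots\otimes a_{n+1})=-f(a_0\otimes\cdots\otimes a_{i-1}a_i^{(1)}\otimes S(a_i^{(2)})\otimes a_i^{(3)}a_{i+1}\otimes\cdots\otimes a_{n+1})\quad(1\le i\le n).$$ The invariants $CS_{\mathrm e}^n(A,M)=C_{\mathrm e}^n(A,M)^{S_{n+1}}$ form a subcomplex, and $\mathrm{HHS}^n(A,M)=\mathrm H^n(CS_{\mathrm e}^\bullet(A,M))$. *)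

theory Defs
  imports
    Complex_Main
    "HOL-Library.Poly_Mapping"
    "HOL-Library.Function_Algebras"
    "HOL-Library.Set_Algebras"
    "HOL-Combinatorics.Permutations"
begin

section \<open>Quotient vector spaces\<close>

record ('k, 'v) vspace =
  vcarrier :: "'v set"
  vadd :: "'v \<Rightarrow> 'v \<Rightarrow> 'v"
  vscale :: "'k \<Rightarrow> 'v \<Rightarrow> 'v"

text \<open>
  The quotient \<open>V / W\<close> of two subspaces of an ambient space with scalar multiplication \<open>s\<close>; its
  elements are the cosets \<open>v + W\<close>. Elementwise addition of sets is the addition of cosets. In the
  scalar multiplication the summand \<open>W\<close> is needed only for the scalar \<open>0\<close>, since \<open>0 (v + W)\<close> has to
  be \<open>W\<close> and not \<open>{0}\<close>.
\<close>

definition coset_scale ::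
    "('k \<Rightarrow> 'v \<Rightarrow> 'v) \<Rightarrow> 'v::ab_group_add set \<Rightarrow> 'k \<Rightarrow> 'v set \<Rightarrow> 'v set" where
  "coset_scale s W c X = s c ` X + W"

definition quotient_space ::
    "('k \<Rightarrow> 'v \<Rightarrow> 'v) \<Rightarrow> 'v::ab_group_add set \<Rightarrow> 'v set \<Rightarrow> ('k, 'v set) vspace" where
  "quotient_space s V W =
     \<lparr>vcarrier = (\<lambda>v. v +o W) ` V, vadd = (+), vscale = coset_scale s W\<rparr>"

definition vspace_iso :: "('k, 'u) vspace \<Rightarrow> ('k, 'v) vspace \<Rightarrow> bool"  (infix \<open>\<cong>\<^sub>k\<close> 50) where
  "U \<cong>\<^sub>k V \<longleftrightarrow> (\<exists>\<phi>. bij_betw \<phi> (vcarrier U) (vcarrier V) \<and>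
     (\<forall>x\<in>vcarrier U. \<forall>y\<in>vcarrier U. \<phi> (vadd U x y) = vadd V (\<phi> x) (\<phi> y)) \<and>
     (\<forall>c. \<forall>x\<in>vcarrier U. \<phi> (vscale U c x) = vscale V c (\<phi> x)))"

section \<open>Tensor powers\<close>

text \<open>
  \<open>'a list \<Rightarrow>\<^sub>0 'k\<close> is the vector space with basis the lists over \<open>'a\<close>. The tensor power of order \<open>n\<close>
  is the span of the lists of length \<open>n\<close> modulo the relations of multilinearity, where
  \<open>sc\<close> is the scalar multiplication of \<open>'a\<close>; the list \<open>[x1, ..., xn]\<close> represents the pure tensor of
  its entries.
\<close>

definition free_scale :: "'k::field \<Rightarrow> ('b \<Rightarrow>\<^sub>0 'k) \<Rightarrow> ('b \<Rightarrow>\<^sub>0 'k)" where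
  "free_scale c f = Poly_Mapping.map ((*) c) f"

definition tensor_rel :: "('k::field \<Rightarrow> 'a::ab_group_add \<Rightarrow> 'a) \<Rightarrow> nat \<Rightarrow> ('a list \<Rightarrow>\<^sub>0 'k) set" where
  "tensor_rel sc n = module.span free_scale
     ({Poly_Mapping.single (us @ [x + y] @ vs) 1
         - Poly_Mapping.single (us @ [x] @ vs) 1 - Poly_Mapping.single (us @ [y] @ vs) 1
       | us x y vs. length us + 1 + length vs = n}
    \<union> {Poly_Mapping.single (us @ [sc c x] @ vs) 1 - Poly_Mapping.single (us @ [x] @ vs) c
       | us c x vs. length us + 1 + length vs = n})"

definition tensor_space ::
    "('k::field \<Rightarrow> 'a::ab_group_add \<Rightarrow> 'a) \<Rightarrow> nat \<Rightarrow> ('k, ('a list \<Rightarrow>\<^sub>0 'k) set) vspace" where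
  "tensor_space sc n = quotient_space free_scale
     {f. Poly_Mapping.keys f \<subseteq> {xs. length xs = n}} (tensor_rel sc n)"

abbreviation tensors :: "('k::field \<Rightarrow> 'a::ab_group_add \<Rightarrow> 'a) \<Rightarrow> nat \<Rightarrow> ('a list \<Rightarrow>\<^sub>0 'k) set set" where
  "tensors sc n \<equiv> vcarrier (tensor_space sc n)"

definition tensor_class ::
    "('k::field \<Rightarrow> 'a::ab_group_add \<Rightarrow> 'a) \<Rightarrow> nat \<Rightarrow> ('a list \<Rightarrow>\<^sub>0 'k) \<Rightarrow> ('a list \<Rightarrow>\<^sub>0 'k) set" where
  "tensor_class sc n f = f +o tensor_rel sc n"

text \<open>
  \<open>linear_ext s G f\<close> is the value at \<open>f\<close> of the linear extension of \<open>G\<close>, where \<open>s\<close> is the scalar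
  multiplication of the target. \<open>tensor_lift s G t\<close> evaluates it at a chosen representative of the
  tensor \<open>t\<close>: if \<open>G\<close> is multilinear then this is the value at \<open>t\<close> of the induced linear map. When the
  target is itself a tensor power, \<open>G\<close> takes values in the free space, and
  is multilinear only modulo \<open>tensor_rel\<close>, so that one has to pass to the class of the result.
  In Sweedler notation, the sum of \<open>G [a1, a2]\<close> over the coproduct of \<open>a\<close>
  is \<open>tensor_lift s G (coprod H a)\<close>.
\<close>

definition linear_ext ::
    "('k::field \<Rightarrow> 'v::ab_group_add \<Rightarrow> 'v) \<Rightarrow> ('b \<Rightarrow> 'v) \<Rightarrow> ('b \<Rightarrow>\<^sub>0 'k) \<Rightarrow> 'v" where
  "linear_ext s G f = (\<Sum>xs\<in>Poly_Mapping.keys f. s (Poly_Mapping.lookup f xs) (G xs))"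

definition tensor_lift ::
    "('k::field \<Rightarrow> 'v::ab_group_add \<Rightarrow> 'v) \<Rightarrow> ('a list \<Rightarrow> 'v) \<Rightarrow> ('a list \<Rightarrow>\<^sub>0 'k) set \<Rightarrow> 'v" where
  "tensor_lift s G t = linear_ext s G (SOME f. f \<in> t)"

abbreviation pure :: "'a list \<Rightarrow> ('a list \<Rightarrow>\<^sub>0 'k::field)" where
  "pure xs \<equiv> Poly_Mapping.single xs 1"

abbreviation free_lift ::
    "('a list \<Rightarrow> ('b list \<Rightarrow>\<^sub>0 'k::field)) \<Rightarrow> ('a list \<Rightarrow>\<^sub>0 'k) set \<Rightarrow> ('b list \<Rightarrow>\<^sub>0 'k)" where
  "free_lift \<equiv> tensor_lift free_scale"

section \<open>Hopf algebras\<close>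

text \<open>
  The underlying ring of the Hopf algebra is the type \<open>'a\<close>. As \<open>\<epsilon>(1) = 1\<close> a Hopf algebra over a field
  is nonzero, so the condition \<open>0 \<noteq> 1\<close> of \<^class>\<open>ring_1\<close> loses no generality.
\<close>

record (overloaded) ('k::zero, 'a) hopf =
  hscale :: "'k \<Rightarrow> 'a \<Rightarrow> 'a"
  coprod :: "'a \<Rightarrow> ('a list \<Rightarrow>\<^sub>0 'k) set"
  counit :: "'a \<Rightarrow> 'k"
  antipode :: "'a \<Rightarrow> 'a"

text \<open>The iterated coproduct \<open>a\<^sup>(\<^sup>1\<^sup>) \<otimes> a\<^sup>(\<^sup>2\<^sup>) \<otimes> a\<^sup>(\<^sup>3\<^sup>)\<close>, as \<open>(\<Delta> \<otimes> id) \<Delta>\<close>.\<close>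

definition coprod3 :: "('k::field, 'a::ring_1) hopf \<Rightarrow> 'a \<Rightarrow> ('a list \<Rightarrow>\<^sub>0 'k) set" where
  "coprod3 H a = tensor_class (hscale H) 3
     (free_lift (\<lambda>xs. free_lift (\<lambda>ys. pure [ys ! 0, ys ! 1, xs ! 1]) (coprod H (xs ! 0)))
       (coprod H a))"

locale hopf_algebra =
  fixes H :: "('k::field, 'a::ring_1) hopf"
  assumes hscale_vector_space: "vector_space (hscale H)"
    and scale_mult_left: "hscale H c (a * b) = hscale H c a * b"
    and scale_mult_right: "hscale H c (a * b) = a * hscale H c b"
    and coprod_closed: "coprod H a \<in> tensors (hscale H) 2"
    and coprod_add: "coprod H (a + b) = vadd (tensor_space (hscale H) 2) (coprod H a) (coprod H b)"
    and coprod_scale: "coprod H (hscale H c a) = vscale (tensor_space (hscale H) 2) c (coprod H a)"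
    and coprod_one: "coprod H 1 = tensor_class (hscale H) 2 (pure [1, 1])"
    and coprod_mult: "coprod H (a * b) = tensor_class (hscale H) 2
          (free_lift (\<lambda>xs. free_lift (\<lambda>ys. pure [xs ! 0 * ys ! 0, xs ! 1 * ys ! 1]) (coprod H b))
            (coprod H a))"
    and counit_linear: "Vector_Spaces.linear (hscale H) (*) (counit H)"
    and counit_one: "counit H 1 = 1"
    and counit_mult: "counit H (a * b) = counit H a * counit H b"
    and coassoc: "coprod3 H a = tensor_class (hscale H) 3
          (free_lift (\<lambda>xs. free_lift (\<lambda>ys. pure [xs ! 0, ys ! 0, ys ! 1]) (coprod H (xs ! 1)))
            (coprod H a))"
    and counit_left:
      "tensor_lift (hscale H) (\<lambda>xs. hscale H (counit H (xs ! 0)) (xs ! 1)) (coprod H a) = a"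
    and counit_right:
      "tensor_lift (hscale H) (\<lambda>xs. hscale H (counit H (xs ! 1)) (xs ! 0)) (coprod H a) = a"
    and antipode_linear: "Vector_Spaces.linear (hscale H) (hscale H) (antipode H)"
    and antipode_left: "tensor_lift (hscale H) (\<lambda>xs. antipode H (xs ! 0) * xs ! 1) (coprod H a)
          = hscale H (counit H a) 1"
    and antipode_right: "tensor_lift (hscale H) (\<lambda>xs. xs ! 0 * antipode H (xs ! 1)) (coprod H a)
          = hscale H (counit H a) 1"

locale cocommutative_hopf_algebra = hopf_algebra +
  assumes cocommutative:
    "tensor_class (hscale H) 2 (free_lift (\<lambda>xs. pure [xs ! 1, xs ! 0]) (coprod H a)) = coprod H a"

section \<open>Modules and bimodules\<close>

record ('k, 'a, 'm) lmodule =
  mscale :: "'k \<Rightarrow> 'm \<Rightarrow> 'm"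
  lact :: "'a \<Rightarrow> 'm \<Rightarrow> 'm"

record ('k, 'a, 'm) bimodule = "('k, 'a, 'm) lmodule" +
  ract :: "'m \<Rightarrow> 'a \<Rightarrow> 'm"

text \<open>Bimodules are modules over \<open>A \<otimes> A\<^sup>o\<^sup>p\<close>, so \<open>k\<close> acts in the same way from both sides.\<close>

locale hopf_bimodule =
  fixes H :: "('k::field, 'a::ring_1) hopf"
    and M :: "('k, 'a, 'm::ab_group_add) bimodule"
  assumes mscale_vector_space: "vector_space (mscale M)"
    and lact_add_left: "lact M (a + b) m = lact M a m + lact M b m"
    and lact_add_right: "lact M a (m + m') = lact M a m + lact M a m'"
    and lact_scale_left: "lact M (hscale H c a) m = mscale M c (lact M a m)"
    and lact_scale_right: "lact M a (mscale M c m) = mscale M c (lact M a m)"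
    and lact_one: "lact M 1 m = m"
    and lact_mult: "lact M (a * b) m = lact M a (lact M b m)"
    and ract_add_left: "ract M (m + m') a = ract M m a + ract M m' a"
    and ract_add_right: "ract M m (a + b) = ract M m a + ract M m b"
    and ract_scale_left: "ract M (mscale M c m) a = mscale M c (ract M m a)"
    and ract_scale_right: "ract M m (hscale H c a) = mscale M c (ract M m a)"
    and ract_one: "ract M m 1 = m"
    and ract_mult: "ract M m (a * b) = ract M (ract M m a) b"
    and lact_ract: "lact M a (ract M m b) = ract M (lact M a m) b"

definition ad :: "('k::field, 'a::ring_1) hopf \<Rightarrow> ('k, 'a, 'm::ab_group_add) bimodule
    \<Rightarrow> ('k, 'a, 'm) lmodule" where
  "ad H M = \<lparr>mscale = mscale M,
     lact = (\<lambda>a m. tensor_lift (mscale M)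
       (\<lambda>xs. ract M (lact M (xs ! 0) m) (antipode H (xs ! 1))) (coprod H a))\<rparr>"

section \<open>Cochain complexes of spaces of functions\<close>

text \<open>
  Linear maps on tensor powers are functions that vanish outside the tensor power, so
  that spaces of cochains are subspaces of a function space.
\<close>

definition restrict0 :: "'t set \<Rightarrow> ('t \<Rightarrow> 'm::zero) \<Rightarrow> 't \<Rightarrow> 'm" where
  "restrict0 T f = (\<lambda>t. if t \<in> T then f t else 0)"

definition linear_maps :: "('k, 't) vspace \<Rightarrow> ('k \<Rightarrow> 'm::ab_group_add \<Rightarrow> 'm) \<Rightarrow> ('t \<Rightarrow> 'm) set" where
  "linear_maps T s = {f. (\<forall>t. t \<notin> vcarrier T \<longrightarrow> f t = 0)
     \<and> (\<forall>t\<in>vcarrier T. \<forall>u\<in>vcarrier T. f (vadd T t u) = f t + f u)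
     \<and> (\<forall>c. \<forall>t\<in>vcarrier T. f (vscale T c t) = s c (f t))}"

definition fun_scale :: "('k \<Rightarrow> 'm \<Rightarrow> 'm) \<Rightarrow> 'k \<Rightarrow> ('t \<Rightarrow> 'm) \<Rightarrow> 't \<Rightarrow> 'm" where
  "fun_scale s c f = (\<lambda>t. s c (f t))"

text \<open>
  Let \<open>\<sigma> i\<close>, for \<open>1 \<le> i \<le> n\<close>, be the operators by which the transpositions \<open>(i, i+1)\<close> act.
  \<open>perm_acts n \<sigma> \<pi> F\<close> says that the permutation \<open>\<pi>\<close> of \<open>{1..n+1}\<close> acts by the operator \<open>F\<close>,
  as computed from some expression of \<open>\<pi>\<close> as a product of these transpositions.
\<close>

inductive perm_acts :: "nat \<Rightarrow> (nat \<Rightarrow> 'f \<Rightarrow> 'f) \<Rightarrow> (nat \<Rightarrow> nat) \<Rightarrow> ('f \<Rightarrow> 'f) \<Rightarrow> bool"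
  for n :: nat and \<sigma> :: "nat \<Rightarrow> 'f \<Rightarrow> 'f" where
  perm_id: "perm_acts n \<sigma> id id"
| perm_step: "perm_acts n \<sigma> \<pi> F \<Longrightarrow> 1 \<le> i \<Longrightarrow> i \<le> n \<Longrightarrow>
    perm_acts n \<sigma> (transpose i (i + 1) \<circ> \<pi>) (\<sigma> i \<circ> F)"

definition sym_invariants :: "nat \<Rightarrow> (nat \<Rightarrow> 'f \<Rightarrow> 'f) \<Rightarrow> 'f set \<Rightarrow> 'f set" where
  "sym_invariants n \<sigma> C =
     {f \<in> C. \<forall>\<pi> F. \<pi> permutes {1..n+1} \<longrightarrow> perm_acts n \<sigma> \<pi> F \<longrightarrow> F f = f}"

text \<open>\<open>\<delta> n\<close> is the differential from degree \<open>n\<close> to degree \<open>n + 1\<close>.\<close>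

definition cohomology :: "('k \<Rightarrow> 'f::ab_group_add \<Rightarrow> 'f) \<Rightarrow> (nat \<Rightarrow> 'f set) \<Rightarrow> (nat \<Rightarrow> 'f \<Rightarrow> 'f) \<Rightarrow> nat
    \<Rightarrow> ('k, 'f set) vspace" where
  "cohomology s C \<delta> n = quotient_space s {f \<in> C n. \<delta> n f = 0}
     (case n of 0 \<Rightarrow> {0} | Suc m \<Rightarrow> \<delta> m ` C m)"

section \<open>Symmetric cohomology\<close>

text \<open>
  In this and the next section \<open>xs\<close> is the list of the tensor factors \<open>a\<^sub>0, a\<^sub>1, ...\<close>, whose number
  is \<open>n + 1\<close> or \<open>n + 2\<close>, respectively.
\<close>

definition left_mult ::
    "('k::field, 'a::ring_1) hopf \<Rightarrow> nat \<Rightarrow> 'a \<Rightarrow> ('a list \<Rightarrow>\<^sub>0 'k) set \<Rightarrow> ('a list \<Rightarrow>\<^sub>0 'k) set" where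
  "left_mult H m b t =
     tensor_class (hscale H) m (free_lift (\<lambda>xs. pure ((b * hd xs) # tl xs)) t)"

definition right_mult ::
    "('k::field, 'a::ring_1) hopf \<Rightarrow> nat \<Rightarrow> ('a list \<Rightarrow>\<^sub>0 'k) set \<Rightarrow> 'a \<Rightarrow> ('a list \<Rightarrow>\<^sub>0 'k) set" where
  "right_mult H m t c =
     tensor_class (hscale H) m (free_lift (\<lambda>xs. pure (butlast xs @ [last xs * c])) t)"

text \<open>\<open>a\<^sub>0 \<otimes> \<cdots> \<otimes> a\<^sub>ia\<^sub>i\<^sub>+\<^sub>1 \<otimes> \<cdots>\<close>\<close>

definition merge :: "nat \<Rightarrow> 'a::times list \<Rightarrow> 'a list" where
  "merge i xs = take i xs @ [xs ! i * xs ! (i + 1)] @ drop (i + 2) xs"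

text \<open>
  The linear endomorphisms of the tensor power with \<open>m\<close> factors which occur in the actions of the
  transpositions, for the factors with indices \<open>i-1, i, i+1\<close> and for the last two factors.
\<close>

definition twist ::
    "('k::field, 'a::ring_1) hopf \<Rightarrow> nat \<Rightarrow> nat \<Rightarrow> ('a list \<Rightarrow>\<^sub>0 'k) set \<Rightarrow> ('a list \<Rightarrow>\<^sub>0 'k) set" where
  "twist H m i t = tensor_class (hscale H) m
     (free_lift (\<lambda>xs. free_lift (\<lambda>ys. pure (take (i - 1) xs
         @ [xs ! (i - 1) * ys ! 0, antipode H (ys ! 1), ys ! 2 * xs ! (i + 1)]
         @ drop (i + 2) xs)) (coprod3 H (xs ! i))) t)"

definition twist_last ::
    "('k::field, 'a::ring_1) hopf \<Rightarrow> nat \<Rightarrow> ('a list \<Rightarrow>\<^sub>0 'k) set \<Rightarrow> ('a list \<Rightarrow>\<^sub>0 'k) set" where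
  "twist_last H m t = tensor_class (hscale H) m
     (free_lift (\<lambda>xs. free_lift (\<lambda>ys. pure (take (m - 2) xs
         @ [xs ! (m - 2) * ys ! 0, antipode H (ys ! 1)])) (coprod H (xs ! (m - 1)))) t)"

definition sym_d ::
    "('k::field, 'a::ring_1) hopf \<Rightarrow> nat \<Rightarrow> ('a list \<Rightarrow>\<^sub>0 'k) set \<Rightarrow> ('a list \<Rightarrow>\<^sub>0 'k) set" where
  "sym_d H n t = tensor_class (hscale H) n
     (free_lift (\<lambda>xs. (\<Sum>i<n. free_scale ((-1) ^ i) (pure (merge i xs)))
        + free_scale ((-1) ^ n * counit H (xs ! n)) (pure (take n xs))) t)"

definition sym_C :: "('k::field, 'a::ring_1) hopf \<Rightarrow> ('k, 'a, 'm::ab_group_add) lmodule \<Rightarrow> nat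
    \<Rightarrow> (('a list \<Rightarrow>\<^sub>0 'k) set \<Rightarrow> 'm) set" where
  "sym_C H N n = {f \<in> linear_maps (tensor_space (hscale H) (n + 1)) (mscale N).
     \<forall>b. \<forall>t\<in>tensors (hscale H) (n + 1). f (left_mult H (n + 1) b t) = lact N b (f t)}"

definition sym_delta :: "('k::field, 'a::ring_1) hopf \<Rightarrow> nat
    \<Rightarrow> (('a list \<Rightarrow>\<^sub>0 'k) set \<Rightarrow> 'm::zero) \<Rightarrow> ('a list \<Rightarrow>\<^sub>0 'k) set \<Rightarrow> 'm" where
  "sym_delta H n f = restrict0 (tensors (hscale H) (n + 2)) (\<lambda>t. f (sym_d H (n + 1) t))"

definition sym_sigma :: "('k::field, 'a::ring_1) hopf \<Rightarrow> nat \<Rightarrow> nat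
    \<Rightarrow> (('a list \<Rightarrow>\<^sub>0 'k) set \<Rightarrow> 'm::ab_group_add) \<Rightarrow> ('a list \<Rightarrow>\<^sub>0 'k) set \<Rightarrow> 'm" where
  "sym_sigma H n i f = restrict0 (tensors (hscale H) (n + 1))
     (\<lambda>t. - f (if i < n then twist H (n + 1) i t else twist_last H (n + 1) t))"

definition sym_CS :: "('k::field, 'a::ring_1) hopf \<Rightarrow> ('k, 'a, 'm::ab_group_add) lmodule \<Rightarrow> nat
    \<Rightarrow> (('a list \<Rightarrow>\<^sub>0 'k) set \<Rightarrow> 'm) set" where
  "sym_CS H N n = sym_invariants n (sym_sigma H n) (sym_C H N n)"

definition HS :: "('k::field, 'a::ring_1) hopf \<Rightarrow> ('k, 'a, 'm::ab_group_add) lmodule \<Rightarrow> nat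
    \<Rightarrow> ('k, (('a list \<Rightarrow>\<^sub>0 'k) set \<Rightarrow> 'm) set) vspace" where
  "HS H N = cohomology (fun_scale (mscale N)) (sym_CS H N) (sym_delta H)"

section \<open>Symmetric Hochschild cohomology\<close>

definition hoch_d ::
    "('k::field, 'a::ring_1) hopf \<Rightarrow> nat \<Rightarrow> ('a list \<Rightarrow>\<^sub>0 'k) set \<Rightarrow> ('a list \<Rightarrow>\<^sub>0 'k) set" where
  "hoch_d H n t = tensor_class (hscale H) (n + 1)
     (free_lift (\<lambda>xs. \<Sum>i\<le>n. free_scale ((-1) ^ i) (pure (merge i xs))) t)"

definition hoch_C :: "('k::field, 'a::ring_1) hopf \<Rightarrow> ('k, 'a, 'm::ab_group_add) bimodule \<Rightarrow> nat
    \<Rightarrow> (('a list \<Rightarrow>\<^sub>0 'k) set \<Rightarrow> 'm) set" where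
  "hoch_C H M n = {f \<in> linear_maps (tensor_space (hscale H) (n + 2)) (mscale M).
     \<forall>t\<in>tensors (hscale H) (n + 2).
       (\<forall>b. f (left_mult H (n + 2) b t) = lact M b (f t)) \<and>
       (\<forall>c. f (right_mult H (n + 2) t c) = ract M (f t) c)}"

definition hoch_delta :: "('k::field, 'a::ring_1) hopf \<Rightarrow> nat
    \<Rightarrow> (('a list \<Rightarrow>\<^sub>0 'k) set \<Rightarrow> 'm::zero) \<Rightarrow> ('a list \<Rightarrow>\<^sub>0 'k) set \<Rightarrow> 'm" where
  "hoch_delta H n f = restrict0 (tensors (hscale H) (n + 3)) (\<lambda>t. f (hoch_d H (n + 1) t))"

definition hoch_sigma :: "('k::field, 'a::ring_1) hopf \<Rightarrow> nat \<Rightarrow> nat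
    \<Rightarrow> (('a list \<Rightarrow>\<^sub>0 'k) set \<Rightarrow> 'm::ab_group_add) \<Rightarrow> ('a list \<Rightarrow>\<^sub>0 'k) set \<Rightarrow> 'm" where
  "hoch_sigma H n i f = restrict0 (tensors (hscale H) (n + 2)) (\<lambda>t. - f (twist H (n + 2) i t))"

definition hoch_CS :: "('k::field, 'a::ring_1) hopf \<Rightarrow> ('k, 'a, 'm::ab_group_add) bimodule \<Rightarrow> nat
    \<Rightarrow> (('a list \<Rightarrow>\<^sub>0 'k) set \<Rightarrow> 'm) set" where
  "hoch_CS H M n = sym_invariants n (hoch_sigma H n) (hoch_C H M n)"

definition HHS :: "('k::field, 'a::ring_1) hopf \<Rightarrow> ('k, 'a, 'm::ab_group_add) bimodule \<Rightarrow> nat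
    \<Rightarrow> ('k, (('a list \<Rightarrow>\<^sub>0 'k) set \<Rightarrow> 'm) set) vspace" where
  "HHS H M = cohomology (fun_scale (mscale M)) (hoch_CS H M) (hoch_delta H)"

end

theory Submission
  imports Defs
begin

text \<open>
  In Sweedler notation the two complexes are identified by
    \<open>(\<Psi> g)(a\<^sub>0 \<otimes> \<cdots> \<otimes> a\<^sub>n\<^sub>+\<^sub>1) = g(a\<^sub>0\<^sup>(\<^sup>1\<^sup>) \<otimes> \<cdots> \<otimes> a\<^sub>n\<^sup>(\<^sup>1\<^sup>)) a\<^sub>0\<^sup>(\<^sup>2\<^sup>) \<cdots> a\<^sub>n\<^sup>(\<^sup>2\<^sup>) a\<^sub>n\<^sub>+\<^sub>1\<close>,
    \<open>(\<Phi> f)(a\<^sub>0 \<otimes> \<cdots> \<otimes> a\<^sub>n) = f(a\<^sub>0\<^sup>(\<^sup>1\<^sup>) \<otimes> \<cdots> \<otimes> a\<^sub>n\<^sup>(\<^sup>1\<^sup>) \<otimes> 1) S(a\<^sub>0\<^sup>(\<^sup>2\<^sup>) \<cdots> a\<^sub>n\<^sup>(\<^sup>2\<^sup>))\<close>,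
  for \<open>g\<close> linear over the adjoint action and \<open>f\<close> a map of bimodules. As the coproduct is
  multiplicative, the product \<open>p\<close> of the \<open>a\<^sub>i\<close> can be treated as a single element, and
  \<open>p\<^sup>(\<^sup>1\<^sup>) S(p\<^sup>(\<^sup>2\<^sup>)) = \<epsilon>(p) = S(p\<^sup>(\<^sup>1\<^sup>)) p\<^sup>(\<^sup>2\<^sup>)\<close> makes \<open>\<Phi>\<close> and \<open>\<Psi>\<close> inverse to each other (\<open>to_sym_to_hoch\<close>,
  \<open>to_hoch_to_sym\<close>). Left linearity of \<open>\<Psi> g\<close> comes from
  \<open>b\<^sup>(\<^sup>1\<^sup>) m S(b\<^sup>(\<^sup>2\<^sup>)) b\<^sup>(\<^sup>3\<^sup>) = b m\<close>, and that of \<open>\<Phi> f\<close> from \<open>S(ab) = S(b) S(a)\<close>.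

  The map \<open>\<Psi>\<close> commutes with the differentials (\<open>to_hoch_d\<close>): merging two factors commutes with
  \<open>\<Delta>\<close> and does not change the product \<open>a\<^sub>0\<^sup>(\<^sup>2\<^sup>) \<cdots> a\<^sub>n\<^sup>(\<^sup>2\<^sup>)\<close>, and the counit in the last term on
  the symmetric side absorbs one half of the coproduct of the last factor. It also commutes with
  the transpositions (\<open>to_hoch_twist\<close>, \<open>to_hoch_twist_last\<close>), and this is where cocommutativity
  enters. Since \<open>\<Delta>(S(a)) = S(a\<^sup>(\<^sup>1\<^sup>)) \<otimes> S(a\<^sup>(\<^sup>2\<^sup>))\<close> and the order of the legs of a coproduct is
  irrelevant, the factors that \<open>\<sigma>\<^sub>i\<close> inserts contribute \<open>a\<^sup>(\<^sup>2\<^sup>) S(a\<^sup>(\<^sup>4\<^sup>)) a\<^sup>(\<^sup>6\<^sup>)\<close> to the product on the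
  right, which collapses to a single leg of \<open>\<Delta>(a)\<close>. Hence \<open>\<Phi>\<close> and \<open>\<Psi>\<close> restrict to inverse
  isomorphisms of the subcomplexes of invariants, and the cohomologies agree.

  All computations are made with functions of lists: a linear map on a tensor power is the same as
  a multilinear function of the factors, and a Sweedler sum is \<open>sw a B\<close>, the value at \<open>\<Delta>(a)\<close> of the
  linear map induced by the bilinear map \<open>B\<close>. An identity between elements of a tensor power is used
  in the form that all multilinear functions with values in the bimodule agree on both sides.
\<close>

section \<open>Linear extensions\<close>

lemma lookup_free_scale [simp]:
  "Poly_Mapping.lookup (free_scale c f) x = c * Poly_Mapping.lookup f x"
  by (simp add: free_scale_def Poly_Mapping.map.rep_eq when_def)

interpretation free: vector_space free_scale
  by unfold_locales (auto intro!: poly_mapping_eqI simp: lookup_add algebra_simps)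

lemmas lin_add = module_hom.add[OF module_hom_linearI]
  and lin_scale = module_hom.scale[OF module_hom_linearI]
  and lin_zero = module_hom.zero[OF module_hom_linearI]
  and lin_diff = module_hom.diff[OF module_hom_linearI]
  and lin_sum = module_hom.sum[OF module_hom_linearI]

context vector_space
begin

lemma linear_ext_superset:
  assumes "finite S" "Poly_Mapping.keys f \<subseteq> S"
  shows "linear_ext scale G f = (\<Sum>x\<in>S. scale (Poly_Mapping.lookup f x) (G x))"
  unfolding linear_ext_def
  by (rule sum.mono_neutral_left) (use assms in \<open>auto simp: in_keys_iff\<close>)

lemma linear_ext_linear: "Vector_Spaces.linear free_scale scale (linear_ext scale G)"
proof -
  have add: "linear_ext scale G (f + g) = linear_ext scale G f + linear_ext scale G g" for f g
    using keys_add[of f g]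
    by (simp add: linear_ext_superset[of "Poly_Mapping.keys f \<union> Poly_Mapping.keys g"]
        lookup_add scale_left_distrib sum.distrib)
  have sc: "linear_ext scale G (free_scale c f) = scale c (linear_ext scale G f)" for c f
    by (subst linear_ext_superset[of "Poly_Mapping.keys f"])
      (auto simp: in_keys_iff linear_ext_def scale_sum_right)
  show ?thesis
    unfolding Vector_Spaces.linear_iff using add sc by (simp add: vector_space_axioms free.vector_space_axioms)
qed

lemmas linear_ext_add = lin_add[OF linear_ext_linear]
  and linear_ext_diff = lin_diff[OF linear_ext_linear]
  and linear_ext_scale = lin_scale[OF linear_ext_linear]
  and linear_ext_sum = lin_sum[OF linear_ext_linear]

lemma linear_ext_single [simp]: "linear_ext scale G (Poly_Mapping.single x c) = scale c (G x)"
  by (subst linear_ext_superset[of "{x}"]) (auto simp: lookup_single)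

lemma linear_ext_add_fun:
  "linear_ext scale (\<lambda>x. G x + G' x) f = linear_ext scale G f + linear_ext scale G' f"
  by (simp add: linear_ext_def scale_right_distrib sum.distrib)

lemma linear_ext_scale_fun:
  "linear_ext scale (\<lambda>x. scale c (G x)) f = scale c (linear_ext scale G f)"
  by (simp add: linear_ext_def scale_sum_right mult.commute)

end

lemma linear_ext_cong:
  "(\<And>x. x \<in> Poly_Mapping.keys f \<Longrightarrow> G x = G' x) \<Longrightarrow> linear_ext s G f = linear_ext s G' f"
  by (simp add: linear_ext_def)

lemma linear_linear_ext:
  assumes "Vector_Spaces.linear s1 s2 h"
  shows "h (linear_ext s1 G f) = linear_ext s2 (\<lambda>x. h (G x)) f"
  by (simp add: linear_ext_def lin_sum[OF assms] lin_scale[OF assms])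

lemma (in vector_space) linear_ext_bind:
  "linear_ext scale G (linear_ext free_scale K f)
    = linear_ext scale (\<lambda>x. linear_ext scale G (K x)) f"
  by (rule linear_linear_ext[OF linear_ext_linear])

text \<open>
  Every element of the free space is the linear combination of its own basis vectors; this reduces
  linear maps to their values on pure tensors.
\<close>

lemma linear_ext_pure: "linear_ext free_scale (\<lambda>x. Poly_Mapping.single x 1) f = f"
proof (rule poly_mapping_eqI)
  show "Poly_Mapping.lookup (linear_ext free_scale (\<lambda>x. Poly_Mapping.single x 1) f) y
      = Poly_Mapping.lookup f y" for y
    by (simp add: linear_ext_def lookup_sum lookup_single when_def in_keys_iff
        if_distrib[of "(*) _"] sum.delta cong: if_cong)
qed

lemma keys_linear_ext_free:
  "Poly_Mapping.keys (linear_ext free_scale K f) \<subseteq> (\<Union>x\<in>Poly_Mapping.keys f. Poly_Mapping.keys (K x))"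
proof
  fix y assume "y \<in> Poly_Mapping.keys (linear_ext free_scale K f)"
  hence "(\<Sum>x\<in>Poly_Mapping.keys f. Poly_Mapping.lookup f x * Poly_Mapping.lookup (K x) y) \<noteq> 0"
    by (simp add: in_keys_iff linear_ext_def lookup_sum)
  then obtain x where "x \<in> Poly_Mapping.keys f" "Poly_Mapping.lookup (K x) y \<noteq> 0"
    by (metis (no_types, lifting) mult_zero_right sum.neutral)
  thus "y \<in> (\<Union>x\<in>Poly_Mapping.keys f. Poly_Mapping.keys (K x))"
    by (auto simp: in_keys_iff)
qed

section \<open>Tensor powers and multilinear functions\<close>

definition multilinear ::
    "('k::field \<Rightarrow> 'a::ab_group_add \<Rightarrow> 'a) \<Rightarrow> ('k \<Rightarrow> 'v::ab_group_add \<Rightarrow> 'v) \<Rightarrow> nat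
      \<Rightarrow> ('a list \<Rightarrow> 'v) \<Rightarrow> bool" where
  "multilinear sc s n G \<longleftrightarrow> (\<forall>us vs. length us + 1 + length vs = n \<longrightarrow>
     Vector_Spaces.linear sc s (\<lambda>x. G (us @ x # vs)))"

text \<open>
  The space of representatives of tensors of order \<open>n\<close>.
\<close>

definition homogeneous :: "nat \<Rightarrow> ('a list \<Rightarrow>\<^sub>0 'k::field) set" where
  "homogeneous n = {f. Poly_Mapping.keys f \<subseteq> {xs. length xs = n}}"

lemma subspace_homogeneous: "free.subspace (homogeneous n :: ('a list \<Rightarrow>\<^sub>0 'k::field) set)"
proof (rule free.subspaceI)
  show "f + g \<in> homogeneous n" if "f \<in> homogeneous n" "g \<in> homogeneous n" for f g :: "'a list \<Rightarrow>\<^sub>0 'k"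
    using that keys_add[of f g] by (auto simp: homogeneous_def)
qed (auto simp: homogeneous_def in_keys_iff)

lemmas homogeneous_add = free.subspace_add[OF subspace_homogeneous]
  and homogeneous_diff = free.subspace_diff[OF subspace_homogeneous]
  and homogeneous_scale = free.subspace_scale[OF subspace_homogeneous]
  and homogeneous_sum = free.subspace_sum[OF subspace_homogeneous]
  and homogeneous_zero = free.subspace_0[OF subspace_homogeneous]

lemma homogeneous_single: "length xs = n \<Longrightarrow> Poly_Mapping.single xs c \<in> homogeneous n"
  by (auto simp: homogeneous_def)

lemma homogeneous_linear_ext:
  "(\<And>x. x \<in> Poly_Mapping.keys f \<Longrightarrow> K x \<in> homogeneous n) \<Longrightarrow> linear_ext free_scale K f \<in> homogeneous n"
  using keys_linear_ext_free[of K f] by (fastforce simp: homogeneous_def)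

lemma subspace_tensor_rel: "free.subspace (tensor_rel sc n)"
  unfolding tensor_rel_def by (rule free.subspace_span)

lemma tensor_rel_homogeneous: "tensor_rel sc n \<subseteq> homogeneous n"
  unfolding tensor_rel_def
  by (rule free.span_minimal[OF _ subspace_homogeneous])
    (auto intro!: homogeneous_diff homogeneous_single)

lemma tensor_class_eqI: "f - g \<in> tensor_rel sc n \<Longrightarrow> tensor_class sc n f = tensor_class sc n g"
  unfolding tensor_class_def
proof -
  assume d: "f - g \<in> tensor_rel sc n"
  have "x \<in> p +o tensor_rel sc n" if "x \<in> q +o tensor_rel sc n" "q - p \<in> tensor_rel sc n" for x p q
    using free.subspace_add[OF subspace_tensor_rel that(2), of "x - q"] that(1)
    unfolding set_minus_plus[symmetric] by simp
  moreover have "g - f \<in> tensor_rel sc n"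
    using free.subspace_neg[OF subspace_tensor_rel d] by simp
  ultimately show "f +o tensor_rel sc n = g +o tensor_rel sc n"
    using d by blast
qed

lemma tensor_class_self: "f \<in> tensor_class sc n f"
  by (auto simp: tensor_class_def elt_set_plus_def free.subspace_0[OF subspace_tensor_rel])

lemma mem_tensor_class: "g \<in> tensor_class sc n f \<Longrightarrow> g - f \<in> tensor_rel sc n"
  by (auto simp: tensor_class_def elt_set_plus_def)

lemma tensors_eq: "tensors sc n = tensor_class sc n ` homogeneous n"
  by (simp add: tensor_space_def quotient_space_def homogeneous_def tensor_class_def[abs_def])

lemma tensor_class_in: "f \<in> homogeneous n \<Longrightarrow> tensor_class sc n f \<in> tensors sc n"
  by (simp add: tensors_eq)

lemma tensor_representative:
  assumes "t \<in> tensors sc n"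
  shows "(SOME f. f \<in> t) \<in> homogeneous n" "tensor_class sc n (SOME f. f \<in> t) = t"
proof -
  obtain f where f: "f \<in> homogeneous n" "t = tensor_class sc n f"
    using assms by (auto simp: tensors_eq)
  let ?g = "SOME f. f \<in> t"
  have "?g \<in> t" using tensor_class_self f(2) by (metis someI_ex)
  hence g: "?g - f \<in> tensor_rel sc n" using f(2) mem_tensor_class by blast
  thus "?g \<in> homogeneous n"
    using homogeneous_add[OF f(1), of "?g - f"] tensor_rel_homogeneous by force
  show "tensor_class sc n ?g = t" using tensor_class_eqI[OF g] f(2) by simp
qed

lemma vadd_tensor_class:
  "vadd (tensor_space sc n) (tensor_class sc n f) (tensor_class sc n g) = tensor_class sc n (f + g)"
proof -
  have "tensor_rel sc n + tensor_rel sc n = tensor_rel sc n"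
    using free.subspace_0[OF subspace_tensor_rel, of sc n]
      free.subspace_add[OF subspace_tensor_rel, of _ sc n]
    by (auto simp: set_plus_def) (metis add.right_neutral)
  thus ?thesis
    by (simp add: tensor_space_def quotient_space_def tensor_class_def set_plus_rearrange)
qed

lemma vscale_tensor_class:
  "vscale (tensor_space sc n) c (tensor_class sc n f) = tensor_class sc n (free_scale c f)"
proof -
  let ?R = "tensor_rel sc n"
  have "free_scale c ` (f +o ?R) + ?R = free_scale c f +o ?R" (is "?A = ?B")
  proof
    show "?A \<subseteq> ?B"
      using free.subspace_scale[OF subspace_tensor_rel, of _ sc n c]
        free.subspace_add[OF subspace_tensor_rel, of _ sc n]
      by (fastforce simp: set_plus_def elt_set_plus_def free.scale_right_distrib add.assoc)
    show "?B \<subseteq> ?A"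
      using free.subspace_0[OF subspace_tensor_rel, of sc n]
      by (force simp: set_plus_def elt_set_plus_def)
  qed
  thus ?thesis
    by (simp add: tensor_space_def quotient_space_def tensor_class_def coset_scale_def)
qed

context vector_space_pair
begin

lemma multilinear_linear:
  "multilinear s1 s2 n G \<Longrightarrow> length us + 1 + length vs = n
    \<Longrightarrow> Vector_Spaces.linear s1 s2 (\<lambda>x. G (us @ x # vs))"
  by (simp add: multilinear_def)

text \<open>
  The universal property of the tensor power: a multilinear function kills the relations, so that
  its linear extension may be evaluated at any representative.
\<close>

lemma linear_ext_tensor_rel:
  assumes G: "multilinear s1 s2 n G" and r: "r \<in> tensor_rel s1 n"
  shows "linear_ext s2 G r = 0"
proof -
  have "tensor_rel s1 n \<subseteq> {r. linear_ext s2 G r = 0}"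
    unfolding tensor_rel_def
  proof (rule free.span_minimal)
    show "free.subspace {r. linear_ext s2 G r = 0}"
      by (auto simp: free.subspace_def vs2.linear_ext_add vs2.linear_ext_scale
          lin_zero[OF vs2.linear_ext_linear])
  qed (auto simp: vs2.linear_ext_diff lin_add[OF multilinear_linear[OF G]]
      lin_scale[OF multilinear_linear[OF G]])
  with r show ?thesis by blast
qed

lemma tensor_lift_class:
  assumes G: "multilinear s1 s2 n G"
  shows "tensor_lift s2 G (tensor_class s1 n f) = linear_ext s2 G f"
proof -
  have "(SOME g. g \<in> tensor_class s1 n f) \<in> tensor_class s1 n f"
    using tensor_class_self by (metis someI_ex)
  from linear_ext_tensor_rel[OF G mem_tensor_class[OF this]] show ?thesis
    by (simp add: vs2.linear_ext_diff tensor_lift_def)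
qed

text \<open>
  Conversely, a linear map on the tensor power is determined by its values on pure tensors.
\<close>

lemma linear_maps_class:
  assumes g: "g \<in> linear_maps (tensor_space s1 n) s2" and f: "f \<in> homogeneous n"
  shows "g (tensor_class s1 n f) = linear_ext s2 (\<lambda>xs. g (tensor_class s1 n (pure xs))) f"
proof -
  have add: "g (tensor_class s1 n (p + q)) = g (tensor_class s1 n p) + g (tensor_class s1 n q)"
    if "p \<in> homogeneous n" "q \<in> homogeneous n" for p q
    using g tensor_class_in[OF that(1), of s1] tensor_class_in[OF that(2), of s1]
    by (simp add: linear_maps_def flip: vadd_tensor_class)
  have sc: "g (tensor_class s1 n (free_scale c p)) = s2 c (g (tensor_class s1 n p))"
    if "p \<in> homogeneous n" for p c
    using g tensor_class_in[OF that(1), of s1]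
    by (simp add: linear_maps_def flip: vscale_tensor_class)
  have zero: "g (tensor_class s1 n 0) = 0"
    using sc[OF homogeneous_zero, of 0] by simp
  have "g (tensor_class s1 n (\<Sum>xs\<in>S. free_scale (c xs) (pure xs)))
      = (\<Sum>xs\<in>S. s2 (c xs) (g (tensor_class s1 n (pure xs))))"
    if "finite S" "S \<subseteq> {xs. length xs = n}" for S c
    using that
  proof (induction S)
    case (insert xs S)
    have 1: "free_scale (c xs) (pure xs) \<in> homogeneous n"
      using insert.prems by (simp add: homogeneous_scale homogeneous_single)
    have 2: "(\<Sum>xs\<in>S. free_scale (c xs) (pure xs)) \<in> homogeneous n"
      using insert.prems by (intro homogeneous_sum homogeneous_scale homogeneous_single) auto
    show ?case
      using insert sc[of "pure xs" "c xs"] by (simp add: add[OF 1 2] homogeneous_single)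
  qed (simp add: zero)
  from this[of "Poly_Mapping.keys f" "Poly_Mapping.lookup f"] f linear_ext_pure[of f]
  show ?thesis by (simp add: linear_ext_def homogeneous_def)
qed

end

text \<open>
  The Hopf algebra laws read the factors of a tensor by indices \<open>0\<close> and \<open>1\<close>, and degrees are written
  \<open>n + 1\<close>; the literal \<open>1\<close> is kept so that these terms match syntactically.
\<close>

declare One_nat_def [simp del]

lemma nth_Cons_one [simp]: "(x # xs) ! 1 = xs ! 0"
  by (simp add: One_nat_def)

section \<open>Sweedler sums\<close>

text \<open>
  Sweedler sums take values in a vector space with scalar multiplication \<open>s\<close>, which will be the
  bimodule. Identities in the Hopf algebra itself are stated after applying an arbitrary linear map
  \<open>h\<close> into this space, so that one target suffices.
\<close>

locale sweedler = cocommutative_hopf_algebra H + vector_space s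
  for H :: "('k::field, 'a::ring_1) hopf" and s :: "'k \<Rightarrow> 'm::ab_group_add \<Rightarrow> 'm"
begin

sublocale vector_space_pair "hscale H" s
  using hscale_vector_space by (simp add: vector_space_pair_def vector_space_axioms)

abbreviation lin :: "('a \<Rightarrow> 'm) \<Rightarrow> bool" where
  "lin \<equiv> Vector_Spaces.linear (hscale H) s"

abbreviation linA :: "('a \<Rightarrow> 'a) \<Rightarrow> bool" where
  "linA \<equiv> Vector_Spaces.linear (hscale H) (hscale H)"

abbreviation \<epsilon> :: "'a \<Rightarrow> 'k" where "\<epsilon> \<equiv> counit H"
abbreviation S :: "'a \<Rightarrow> 'a" where "S \<equiv> antipode H"

definition bilin :: "('a \<Rightarrow> 'a \<Rightarrow> 'm) \<Rightarrow> bool" where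
  "bilin B \<longleftrightarrow> (\<forall>y. lin (\<lambda>x. B x y)) \<and> (\<forall>x. lin (\<lambda>y. B x y))"

definition trilin :: "('a \<Rightarrow> 'a \<Rightarrow> 'a \<Rightarrow> 'm) \<Rightarrow> bool" where
  "trilin T \<longleftrightarrow> (\<forall>y z. lin (\<lambda>x. T x y z)) \<and> (\<forall>x z. lin (\<lambda>y. T x y z)) \<and> (\<forall>x y. lin (\<lambda>z. T x y z))"

text \<open>
  In Sweedler notation, \<open>B(a\<^sup>(\<^sup>1\<^sup>), a\<^sup>(\<^sup>2\<^sup>))\<close>.
\<close>

definition sw :: "'a \<Rightarrow> ('a \<Rightarrow> 'a \<Rightarrow> 'm) \<Rightarrow> 'm" where
  "sw a B = tensor_lift s (\<lambda>xs. B (xs ! 0) (xs ! 1)) (coprod H a)"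

lemma bilinI: "(\<And>y. lin (\<lambda>x. B x y)) \<Longrightarrow> (\<And>x. lin (\<lambda>y. B x y)) \<Longrightarrow> bilin B"
  by (simp add: bilin_def)

lemma trilinI:
  "(\<And>y z. lin (\<lambda>x. T x y z)) \<Longrightarrow> (\<And>x z. lin (\<lambda>y. T x y z)) \<Longrightarrow> (\<And>x y. lin (\<lambda>z. T x y z))
    \<Longrightarrow> trilin T"
  by (simp add: trilin_def)

lemma linI:
  "(\<And>x y. f (x + y) = f x + f y) \<Longrightarrow> (\<And>c x. f (hscale H c x) = s c (f x)) \<Longrightarrow> lin f"
  unfolding Vector_Spaces.linear_iff by (simp add: hscale_vector_space vector_space_axioms)

lemma linAI:
  "(\<And>x y. f (x + y) = f x + f y) \<Longrightarrow> (\<And>c x. f (hscale H c x) = hscale H c (f x)) \<Longrightarrow> linA f"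
  unfolding Vector_Spaces.linear_iff by (simp add: hscale_vector_space)

subsection \<open>Linearity\<close>

lemma linA_id: "linA (\<lambda>x. x)"
  by (rule linAI) auto

lemma linA_mult_left: "linA g \<Longrightarrow> linA (\<lambda>x. a * g x)"
  by (rule linAI) (simp_all add: lin_add lin_scale distrib_left scale_mult_right[symmetric])

lemma linA_mult_right: "linA g \<Longrightarrow> linA (\<lambda>x. g x * a)"
  by (rule linAI) (simp_all add: lin_add lin_scale distrib_right scale_mult_left[symmetric])

lemma linA_antipode: "linA g \<Longrightarrow> linA (\<lambda>x. S (g x))"
  by (rule linAI) (simp_all add: lin_add lin_scale lin_add[OF antipode_linear] lin_scale[OF antipode_linear])

lemma lin_comp: "lin f \<Longrightarrow> linA g \<Longrightarrow> lin (\<lambda>x. f (g x))"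
  using Vector_Spaces.linear_compose[of "hscale H" "hscale H" g s f] by (simp add: o_def)

lemma lin_scale_counit: "linA g \<Longrightarrow> lin (\<lambda>x. s (\<epsilon> (g x)) m)"
  by (rule linI) (simp_all add: lin_add lin_scale lin_add[OF counit_linear]
      lin_scale[OF counit_linear] scale_left_distrib)

lemma lin_scaled: "lin f \<Longrightarrow> lin (\<lambda>x. s c (f x))"
  by (rule linI) (simp_all add: lin_add[of "hscale H" s] lin_scale[of "hscale H" s] scale_right_distrib mult.commute)

lemma lin_plus: "lin f \<Longrightarrow> lin g \<Longrightarrow> lin (\<lambda>x. f x + g x)"
  by (rule linI) (simp_all add: lin_add[of "hscale H" s] lin_scale[of "hscale H" s] scale_right_distrib)

lemma lin_uminus: "lin f \<Longrightarrow> lin (\<lambda>x. - f x)"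
  by (rule linI) (simp_all add: lin_add[of "hscale H" s] lin_scale[of "hscale H" s])

lemma lin_sums: "(\<And>i. i \<in> I \<Longrightarrow> lin (f i)) \<Longrightarrow> lin (\<lambda>x. \<Sum>i\<in>I. f i x)"
  by (rule linI) (simp_all add: lin_add[of "hscale H" s] lin_scale[of "hscale H" s] scale_sum_right sum.distrib)

lemma lin_linear_ext: "(\<And>ys. lin (\<lambda>x. G x ys)) \<Longrightarrow> lin (\<lambda>x. linear_ext s (G x) f)"
  unfolding linear_ext_def by (intro lin_sums lin_scaled)

lemma linear_ext_free_lift:
  "linear_ext s G (free_lift K t) = tensor_lift s (\<lambda>xs. linear_ext s G (K xs)) t"
  unfolding tensor_lift_def by (rule linear_ext_bind)

lemma multilinear_pair:
  assumes "bilin B"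
  shows "multilinear (hscale H) s 2 (\<lambda>xs. B (xs ! 0) (xs ! 1))"
  unfolding multilinear_def
proof (intro allI impI)
  fix us vs :: "'a list" assume "length us + 1 + length vs = 2"
  then consider y where "us = []" "vs = [y]" | y where "us = [y]" "vs = []"
    by (cases us; cases vs) auto
  thus "lin (\<lambda>x. B ((us @ x # vs) ! 0) ((us @ x # vs) ! 1))"
    using assms by cases (simp_all add: bilin_def)
qed

lemma multilinear_triple:
  assumes "trilin T"
  shows "multilinear (hscale H) s 3 (\<lambda>xs. T (xs ! 0) (xs ! 1) (xs ! 2))"
  unfolding multilinear_def
proof (intro allI impI)
  fix us vs :: "'a list" assume "length us + 1 + length vs = 3"
  then consider "length us = 0" "length vs = 2" | "length us = 1" "length vs = 1"
    | "length us = 2" "length vs = 0"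
    by linarith
  thus "lin (\<lambda>x. T ((us @ x # vs) ! 0) ((us @ x # vs) ! 1) ((us @ x # vs) ! 2))"
    using assms by cases (auto simp: trilin_def length_Suc_conv numeral_2_eq_2 One_nat_def)
qed

lemma sw_class:
  "bilin B \<Longrightarrow> coprod H a = tensor_class (hscale H) 2 f
    \<Longrightarrow> sw a B = linear_ext s (\<lambda>xs. B (xs ! 0) (xs ! 1)) f"
  by (simp add: sw_def tensor_lift_class[OF multilinear_pair])

lemma lin_sw_inner: "(\<And>x y. lin (\<lambda>z. B z x y)) \<Longrightarrow> lin (\<lambda>z. sw a (B z))"
  unfolding sw_def tensor_lift_def by (rule lin_linear_ext)

text \<open>
  Linearity in the argument needs \<open>B\<close> to be bilinear, because \<open>\<Delta>(a + b)\<close> and \<open>\<Delta>(a) + \<Delta>(b)\<close> agree only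
  as tensors and not as formal sums.
\<close>

lemma lin_sw:
  assumes B: "bilin B"
  shows "lin (\<lambda>a. sw a B)"
proof (rule linI)
  fix a b c
  obtain f g where f: "coprod H a = tensor_class (hscale H) 2 f" and g: "coprod H b = tensor_class (hscale H) 2 g"
    using coprod_closed unfolding tensors_eq by blast
  show "sw (a + b) B = sw a B + sw b B"
    using coprod_add[of a b, unfolded f g vadd_tensor_class]
    by (simp add: sw_class[OF B] f g linear_ext_add)
  show "sw (hscale H c a) B = s c (sw a B)"
    using coprod_scale[of c a, unfolded f vscale_tensor_class]
    by (simp add: sw_class[OF B] f linear_ext_scale)
qed

lemma lin_sw_arg: "bilin B \<Longrightarrow> linA g \<Longrightarrow> lin (\<lambda>z. sw (g z) B)"
  by (rule lin_comp[OF lin_sw])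

lemma lin2:
  assumes "bilin B" "linA g"
  shows "lin (\<lambda>x. B (g x) y)" "lin (\<lambda>x. B y (g x))"
  using assms lin_comp[of "\<lambda>x. B x y" g] lin_comp[of "\<lambda>x. B y x" g] by (simp_all add: bilin_def)

lemma lin3:
  assumes "trilin T" "linA g"
  shows "lin (\<lambda>x. T (g x) y z)" "lin (\<lambda>x. T y (g x) z)" "lin (\<lambda>x. T y z (g x))"
proof -
  note T = assms(1)[unfolded trilin_def]
  show "lin (\<lambda>x. T (g x) y z)" using T by (intro lin_comp[OF _ assms(2)]) auto
  show "lin (\<lambda>x. T y (g x) z)" using T by (intro lin_comp[OF _ assms(2)]) auto
  show "lin (\<lambda>x. T y z (g x))" using T by (intro lin_comp[OF _ assms(2)]) auto
qed

text \<open>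
  Each rule treats one shape of term, with the variable of linearity in one place; general composition
  would have too many higher-order unifiers. In the terms below that variable occurs exactly once, so
  that \<open>intro\<close> proves linearity without search.
\<close>

lemmas lin_intros = bilinI trilinI linA_id linA_mult_left linA_mult_right linA_antipode
  lin_scaled lin_scale_counit lin_sw_inner lin_sw_arg

subsection \<open>The Hopf algebra laws\<close>

text \<open>
  For fixed representatives of \<open>\<Delta>(a)\<close> and \<open>\<Delta>(b)\<close> both sides are the same finite double sum.
\<close>

lemma sw_swap: "sw a (\<lambda>x y. sw b (\<lambda>u v. C x y u v)) = sw b (\<lambda>u v. sw a (\<lambda>x y. C x y u v))"
  unfolding sw_def tensor_lift_def linear_ext_def scale_sum_right
  by (subst sum.swap) (simp add: mult.commute)

lemma sw_linear: "Vector_Spaces.linear s s h \<Longrightarrow> h (sw a B) = sw a (\<lambda>x y. h (B x y))"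
  unfolding sw_def tensor_lift_def by (rule linear_linear_ext)

lemma linear_scaling: "Vector_Spaces.linear s s (s c)"
  unfolding Vector_Spaces.linear_iff by (simp add: vector_space_axioms scale_right_distrib mult.commute)

lemmas sw_scale = sw_linear[OF linear_scaling]

lemma sw_one: "bilin B \<Longrightarrow> sw 1 B = B 1 1"
  by (simp add: sw_class[OF _ coprod_one])

lemma sw_mult: "bilin B \<Longrightarrow> sw (a * b) B = sw a (\<lambda>x y. sw b (\<lambda>u v. B (x * u) (y * v)))"
  by (subst sw_class[OF _ coprod_mult]) (simp_all add: linear_ext_free_lift sw_def[abs_def])

lemma sw_commute: "bilin B \<Longrightarrow> sw a (\<lambda>x y. B y x) = sw a B"
  by (subst (2) sw_class[OF _ cocommutative[symmetric]])
    (simp_all add: linear_ext_free_lift sw_def[abs_def])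

lemma coprod3_lift:
  assumes "trilin T"
  shows "tensor_lift s (\<lambda>xs. T (xs ! 0) (xs ! 1) (xs ! 2)) (coprod3 H a)
    = sw a (\<lambda>x z. sw x (\<lambda>u v. T u v z))"
  unfolding coprod3_def
  by (simp add: tensor_lift_class[OF multilinear_triple[OF assms]] linear_ext_free_lift sw_def[abs_def])

lemma sw_coassoc:
  assumes "trilin T"
  shows "sw a (\<lambda>x z. sw x (\<lambda>u v. T u v z)) = sw a (\<lambda>x y. sw y (\<lambda>u v. T x u v))"
  unfolding coprod3_lift[OF assms, symmetric] coassoc
  by (simp add: tensor_lift_class[OF multilinear_triple[OF assms]] linear_ext_free_lift sw_def[abs_def])

lemma sw_counit_left:
  assumes "lin h"
  shows "sw a (\<lambda>x y. s (\<epsilon> x) (h y)) = h a"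
  using arg_cong[OF counit_left[of a], of h]
  by (simp add: tensor_lift_def sw_def linear_linear_ext[OF assms] lin_scale[OF assms])

lemma sw_counit_right:
  assumes "lin h"
  shows "sw a (\<lambda>x y. s (\<epsilon> y) (h x)) = h a"
  using arg_cong[OF counit_right[of a], of h]
  by (simp add: tensor_lift_def sw_def linear_linear_ext[OF assms] lin_scale[OF assms])

lemma sw_antipode_left:
  assumes "lin h"
  shows "sw a (\<lambda>x y. h (S x * y)) = s (\<epsilon> a) (h 1)"
  using arg_cong[OF antipode_left[of a], of h]
  by (simp add: tensor_lift_def sw_def linear_linear_ext[OF assms] lin_scale[OF assms])

lemma sw_antipode_right:
  assumes "lin h"
  shows "sw a (\<lambda>x y. h (x * S y)) = s (\<epsilon> a) (h 1)"
  using arg_cong[OF antipode_right[of a], of h]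
  by (simp add: tensor_lift_def sw_def linear_linear_ext[OF assms] lin_scale[OF assms])

subsection \<open>The antipode\<close>

text \<open>
  The usual uniqueness of convolution inverses, written out. Both \<open>\<Delta> \<circ> S\<close> and \<open>(S \<otimes> S) \<circ> \<tau> \<circ> \<Delta>\<close>, where
  \<open>\<tau>\<close> exchanges the two factors, are inverse to \<open>\<Delta>\<close> under convolution, the first from the left and
  the second from the right; \<open>\<tau>\<close> disappears by cocommutativity. Concretely, the unit
  \<open>\<epsilon>(y) 1 \<otimes> 1 = y\<^sup>(\<^sup>1\<^sup>) S(y\<^sup>(\<^sup>4\<^sup>)) \<otimes> y\<^sup>(\<^sup>2\<^sup>) S(y\<^sup>(\<^sup>3\<^sup>))\<close> is inserted behind \<open>\<Delta>(S(x))\<close>, and the product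
  \<open>\<Delta>(S(x)) \<Delta>(u) = \<Delta>(S(x) u)\<close> then cancels.
\<close>

lemma antipode_coprod:
  assumes B: "bilin B"
  shows "sw (S a) B = sw a (\<lambda>x y. B (S x) (S y))"
proof -
  note li = lin_intros lin2[OF B]
  have expand: "s (\<epsilon> y) (B p q)
      = sw y (\<lambda>u v. sw u (\<lambda>u1 u2. sw v (\<lambda>u3 u4. B (p * u1 * S u4) (q * u2 * S u3))))" for p q y
  proof -
    have "sw y (\<lambda>u v. sw u (\<lambda>u1 u2. sw v (\<lambda>u3 u4. B (p * u1 * S u4) (q * u2 * S u3))))
        = sw y (\<lambda>u1 w. sw w (\<lambda>u2 v. sw v (\<lambda>u3 u4. B (p * u1 * S u4) (q * u2 * S u3))))"
      by (rule sw_coassoc) (intro li)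
    also have "\<dots> = sw y (\<lambda>u1 w. sw w (\<lambda>v u4. sw v (\<lambda>u2 u3. B (p * u1 * S u4) (q * (u2 * S u3)))))"
      by (subst sw_coassoc) (intro li, simp add: mult.assoc)
    also have "\<dots> = sw y (\<lambda>u1 w. sw w (\<lambda>v u4. s (\<epsilon> v) (B (p * u1 * S u4) q)))"
      by (subst sw_antipode_right[where h = "\<lambda>z. B _ (q * z)"]) (intro li, simp)
    also have "\<dots> = sw y (\<lambda>u1 w. B (p * (u1 * S w)) q)"
      by (subst sw_counit_left) (intro li, simp add: mult.assoc)
    also have "\<dots> = s (\<epsilon> y) (B p q)"
      by (subst sw_antipode_right[where h = "\<lambda>z. B (p * z) q"]) (intro li, simp)
    finally show ?thesis by simp
  qed
  have "sw (S a) B = sw a (\<lambda>x y. s (\<epsilon> y) (sw (S x) B))"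
    by (rule sw_counit_right[symmetric]) (intro li B)
  also have "\<dots> = sw a (\<lambda>x y. sw y (\<lambda>u v. sw v (\<lambda>u3 u4.
      sw (S x) (\<lambda>p q. sw u (\<lambda>u1 u2. B (p * u1 * S u4) (q * u2 * S u3))))))"
    unfolding sw_scale expand
    by (subst sw_swap, subst (2) sw_swap, subst (3) sw_swap) (rule refl)
  also have "\<dots> = sw a (\<lambda>x y. sw y (\<lambda>u v. sw v (\<lambda>u3 u4.
      sw (S x * u) (\<lambda>p q. B (p * S u4) (q * S u3)))))"
    by (subst sw_mult) (intro li, simp)
  also have "\<dots> = sw a (\<lambda>z v. sw z (\<lambda>x u. sw v (\<lambda>u3 u4.
      sw (S x * u) (\<lambda>p q. B (p * S u4) (q * S u3)))))"
    by (rule sw_coassoc[symmetric]) (intro li)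
  also have "\<dots> = sw a (\<lambda>z v. sw v (\<lambda>u3 u4. sw z (\<lambda>x u.
      sw (S x * u) (\<lambda>p q. B (p * S u4) (q * S u3)))))"
    by (subst sw_swap) (rule refl)
  also have "\<dots> = sw a (\<lambda>z v. s (\<epsilon> z) (sw v (\<lambda>u3 u4. B (S u4) (S u3))))"
    by (subst sw_antipode_left[where h = "\<lambda>z. sw z (\<lambda>p q. B (p * S _) (q * S _))"])
      (intro li, subst sw_one, (intro li), simp add: sw_scale)
  also have "\<dots> = sw a (\<lambda>u3 u4. B (S u4) (S u3))"
    by (rule sw_counit_left) (intro li)
  also have "\<dots> = sw a (\<lambda>x y. B (S x) (S y))"
    by (rule sw_commute) (intro li)
  finally show ?thesis .
qed

text \<open>
  Convolution inverses again, this time of the multiplication \<open>A \<otimes> A \<rightarrow> A\<close>: \<open>S(ab)\<close> inverts it from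
  the left, and \<open>S(b) S(a)\<close> from the right.
\<close>

lemma antipode_mult:
  assumes h: "lin h"
  shows "h (S (a * b)) = h (S b * S a)"
proof -
  note li = lin_intros lin_comp[OF h]
  have expand: "s (\<epsilon> y) (s (\<epsilon> w) (h p))
      = sw y (\<lambda>y1 y2. sw w (\<lambda>w1 w2. h (p * (y1 * w1) * (S w2 * S y2))))" for y w p
  proof -
    have "sw y (\<lambda>y1 y2. sw w (\<lambda>w1 w2. h (p * (y1 * w1) * (S w2 * S y2))))
        = sw y (\<lambda>y1 y2. sw w (\<lambda>w1 w2. h (p * y1 * (w1 * S w2) * S y2)))"
      by (simp add: mult.assoc)
    also have "\<dots> = sw y (\<lambda>y1 y2. s (\<epsilon> w) (h (p * (y1 * S y2))))"
      by (subst sw_antipode_right[where h = "\<lambda>z. h (p * _ * z * S _)"]) (intro li, simp add: mult.assoc)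
    also have "\<dots> = s (\<epsilon> w) (s (\<epsilon> y) (h p))"
      by (subst sw_scale[symmetric], subst sw_antipode_right[where h = "\<lambda>z. h (p * z)"]) (intro li, simp)
    finally show ?thesis by (simp add: mult.commute)
  qed
  have "h (S (a * b)) = sw a (\<lambda>x y. s (\<epsilon> y) (h (S (x * b))))"
    by (rule sw_counit_right[symmetric]) (intro li)
  also have "\<dots> = sw a (\<lambda>x y. s (\<epsilon> y) (sw b (\<lambda>u w. s (\<epsilon> w) (h (S (x * u))))))"
    by (subst sw_counit_right) (intro li, simp)
  also have "\<dots> = sw a (\<lambda>x y. sw y (\<lambda>y1 y2. sw b (\<lambda>u w. sw w (\<lambda>w1 w2.
      h (S (x * u) * (y1 * w1) * (S w2 * S y2))))))"
    unfolding sw_scale expand by (subst sw_swap) (rule refl)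
  also have "\<dots> = sw a (\<lambda>x y. sw y (\<lambda>y1 y2. sw b (\<lambda>c w2. sw c (\<lambda>u w1.
      h (S (x * u) * (y1 * w1) * (S w2 * S y2))))))"
    by (subst (2) sw_coassoc[symmetric]) (intro li, simp)
  also have "\<dots> = sw a (\<lambda>z y2. sw z (\<lambda>x y1. sw b (\<lambda>c w2. sw c (\<lambda>u w1.
      h (S (x * u) * (y1 * w1) * (S w2 * S y2))))))"
    by (rule sw_coassoc[symmetric]) (intro li)
  also have "\<dots> = sw a (\<lambda>z y2. sw b (\<lambda>c w2. sw (z * c) (\<lambda>p q. h (S p * q * (S w2 * S y2)))))"
    by (subst sw_swap, subst sw_mult) (intro li, simp)
  also have "\<dots> = sw a (\<lambda>z y2. sw b (\<lambda>c w2. s (\<epsilon> z) (s (\<epsilon> c) (h (S w2 * S y2)))))"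
    by (subst sw_antipode_left[where h = "\<lambda>p. h (p * _)"]) (intro li, simp add: counit_mult)
  also have "\<dots> = sw a (\<lambda>z y2. s (\<epsilon> z) (h (S b * S y2)))"
    by (subst sw_scale[symmetric], subst sw_counit_left) (intro li, simp)
  also have "\<dots> = h (S b * S a)"
    by (subst sw_counit_left) (intro li, simp)
  finally show ?thesis .
qed

definition quadlin :: "('a \<Rightarrow> 'a \<Rightarrow> 'a \<Rightarrow> 'a \<Rightarrow> 'm) \<Rightarrow> bool" where
  "quadlin F \<longleftrightarrow> (\<forall>x y z. lin (\<lambda>w. F w x y z)) \<and> (\<forall>x y z. lin (\<lambda>w. F x w y z))
     \<and> (\<forall>x y z. lin (\<lambda>w. F x y w z)) \<and> (\<forall>x y z. lin (\<lambda>w. F x y z w))"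

lemma quadlinI:
  "(\<And>x y z. lin (\<lambda>w. F w x y z)) \<Longrightarrow> (\<And>x y z. lin (\<lambda>w. F x w y z))
    \<Longrightarrow> (\<And>x y z. lin (\<lambda>w. F x y w z)) \<Longrightarrow> (\<And>x y z. lin (\<lambda>w. F x y z w)) \<Longrightarrow> quadlin F"
  by (simp add: quadlin_def)

lemma lin4:
  assumes "quadlin F" "linA g"
  shows "lin (\<lambda>w. F (g w) x y z)" "lin (\<lambda>w. F x (g w) y z)" "lin (\<lambda>w. F x y (g w) z)" "lin (\<lambda>w. F x y z (g w))"
proof -
  note T = assms(1)[unfolded quadlin_def]
  show "lin (\<lambda>w. F (g w) x y z)" using T by (intro lin_comp[OF _ assms(2)]) auto
  show "lin (\<lambda>w. F x (g w) y z)" using T by (intro lin_comp[OF _ assms(2)]) auto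
  show "lin (\<lambda>w. F x y (g w) z)" using T by (intro lin_comp[OF _ assms(2)]) auto
  show "lin (\<lambda>w. F x y z (g w))" using T by (intro lin_comp[OF _ assms(2)]) auto
qed

text \<open>
  Cocommutativity permits the exchange of the second and third of four legs, after the sum has been
  reassociated so that these two come from one coproduct.
\<close>

lemma sw_middle_swap:
  assumes F: "quadlin F"
  shows "sw x (\<lambda>a b. sw a (\<lambda>a1 a2. sw b (\<lambda>b1 b2. F a1 b1 a2 b2)))
    = sw x (\<lambda>a b. sw a (\<lambda>a1 a2. sw b (\<lambda>b1 b2. F a1 a2 b1 b2)))"
proof -
  have reassociate: "sw x (\<lambda>a b. sw a (\<lambda>a1 a2. sw b (\<lambda>b1 b2. G a1 a2 b1 b2)))
      = sw x (\<lambda>a1 w. sw w (\<lambda>c b2. sw c (\<lambda>a2 b1. G a1 a2 b1 b2)))" if G: "quadlin G" for G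
  proof -
    note li = lin_intros lin4[OF G]
    have "sw x (\<lambda>a b. sw a (\<lambda>a1 a2. sw b (\<lambda>b1 b2. G a1 a2 b1 b2)))
        = sw x (\<lambda>a1 w. sw w (\<lambda>a2 b. sw b (\<lambda>b1 b2. G a1 a2 b1 b2)))"
      by (rule sw_coassoc) (intro li)
    also have "\<dots> = sw x (\<lambda>a1 w. sw w (\<lambda>c b2. sw c (\<lambda>a2 b1. G a1 a2 b1 b2)))"
      by (subst (2) sw_coassoc[symmetric]) (intro li, simp)
    finally show ?thesis .
  qed
  note li = lin_intros quadlinI lin4[OF F]
  have "sw x (\<lambda>a b. sw a (\<lambda>a1 a2. sw b (\<lambda>b1 b2. F a1 b1 a2 b2)))
      = sw x (\<lambda>a1 w. sw w (\<lambda>c b2. sw c (\<lambda>a2 b1. F a1 b1 a2 b2)))"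
    by (rule reassociate) (intro li)
  also have "\<dots> = sw x (\<lambda>a1 w. sw w (\<lambda>c b2. sw c (\<lambda>a2 b1. F a1 a2 b1 b2)))"
    by (subst (3) sw_commute) (intro li, simp)
  also have "\<dots> = sw x (\<lambda>a b. sw a (\<lambda>a1 a2. sw b (\<lambda>b1 b2. F a1 a2 b1 b2)))"
    by (rule reassociate[symmetric, OF F])
  finally show ?thesis .
qed

text \<open>
  In the summand the legs \<open>a\<^sup>(\<^sup>2\<^sup>)\<close> and \<open>b\<^sup>(\<^sup>2\<^sup>)\<close> belong to different coproducts; after exchanging the
  middle legs they become the two legs of one coproduct and the antipode cancels them.
\<close>

lemma sw_cancel_pair:
  assumes T: "trilin T"
  shows "sw x (\<lambda>a b. sw a (\<lambda>a1 a2. sw b (\<lambda>b1 b2. T a1 b1 (a2 * S b2)))) = sw x (\<lambda>a b. T a b 1)"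
proof -
  note li = lin_intros quadlinI lin3[OF T]
  have "sw x (\<lambda>a b. sw a (\<lambda>a1 a2. sw b (\<lambda>b1 b2. T a1 b1 (a2 * S b2))))
      = sw x (\<lambda>a b. sw a (\<lambda>a1 a2. sw b (\<lambda>b1 b2. T a1 a2 (b1 * S b2))))"
    by (rule sw_middle_swap) (intro li)
  also have "\<dots> = sw x (\<lambda>a b. s (\<epsilon> b) (sw a (\<lambda>a1 a2. T a1 a2 1)))"
    by (subst sw_antipode_right[where h = "T _ _"]) (intro li, simp add: sw_scale)
  also have "\<dots> = sw x (\<lambda>a b. T a b 1)"
    by (rule sw_counit_right) (intro li)
  finally show ?thesis .
qed

text \<open>
  In Sweedler notation, \<open>T(a\<^sup>(\<^sup>1\<^sup>), a\<^sup>(\<^sup>2\<^sup>), a\<^sup>(\<^sup>3\<^sup>))\<close>.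
\<close>

definition sw3 :: "'a \<Rightarrow> ('a \<Rightarrow> 'a \<Rightarrow> 'a \<Rightarrow> 'm) \<Rightarrow> 'm" where
  "sw3 a T = sw a (\<lambda>x z. sw x (\<lambda>u v. T u v z))"

text \<open>
  For the last transposition, where the leg \<open>c\<close> is not split: the second legs of \<open>a\<close> and \<open>b\<close>, which
  go to the product on the right, cancel.
\<close>

lemma sw3_cancel_pair:
  assumes T: "quadlin T"
  shows "sw3 q (\<lambda>a b c. sw a (\<lambda>a1 a2. sw b (\<lambda>b1 b2. T a1 b1 (a2 * S b2) c)))
    = sw3 q (\<lambda>a b c. T a b 1 c)"
  unfolding sw3_def
  by (subst sw_cancel_pair[where T = "\<lambda>x y z. T x y z _"]) (intro lin_intros lin4[OF T], rule refl)

text \<open>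
  For the other transpositions: of the six legs of \<open>q\<close>, three enter the cochain and the other three
  multiply to \<open>a\<^sup>(\<^sup>2\<^sup>) S(b\<^sup>(\<^sup>2\<^sup>)) c\<^sup>(\<^sup>2\<^sup>)\<close>, in which the first two cancel. What remains is one further leg
  \<open>q2\<close> of \<open>q\<close>.
\<close>

lemma sw3_cancel:
  assumes T: "quadlin T"
  shows "sw3 q (\<lambda>a b c. sw a (\<lambda>a1 a2. sw b (\<lambda>b1 b2. sw c (\<lambda>c1 c2. T a1 b1 c1 (a2 * S b2 * c2)))))
    = sw q (\<lambda>q1 q2. sw3 q1 (\<lambda>a b c. T a b c q2))"
proof -
  note li = lin_intros quadlinI lin4[OF T]
  have "sw3 q (\<lambda>a b c. sw a (\<lambda>a1 a2. sw b (\<lambda>b1 b2. sw c (\<lambda>c1 c2. T a1 b1 c1 (a2 * S b2 * c2)))))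
      = sw q (\<lambda>x c. sw c (\<lambda>c1 c2. sw x (\<lambda>a b. sw a (\<lambda>a1 a2. sw b (\<lambda>b1 b2. T a1 b1 c1 (a2 * S b2 * c2))))))"
    unfolding sw3_def
    by (subst (3) sw_swap, subst (2) sw_swap, subst (2) sw_swap) (rule refl)
  also have "\<dots> = sw q (\<lambda>x c. sw c (\<lambda>c1 c2. sw x (\<lambda>a b. T a b c1 c2)))"
    by (subst sw_cancel_pair[where T = "\<lambda>a b d. T a b _ (d * _)"]) (intro li, simp)
  also have "\<dots> = sw q (\<lambda>q1 q2. sw q1 (\<lambda>x c. sw x (\<lambda>a b. T a b c q2)))"
    by (rule sw_coassoc[symmetric]) (intro li)
  finally show ?thesis unfolding sw3_def .
qed

section \<open>Sweedler sums over lists\<close>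

text \<open>
  The Sweedler sum with \<open>\<Delta>\<close> applied to every entry of a list: \<open>B\<close> receives the list of the first
  and the list of the second legs.
\<close>

primrec lsw :: "'a list \<Rightarrow> ('a list \<Rightarrow> 'a list \<Rightarrow> 'm) \<Rightarrow> 'm" where
  "lsw [] B = B [] []"
| "lsw (x # xs) B = sw x (\<lambda>u v. lsw xs (\<lambda>us vs. B (u # us) (v # vs)))"

text \<open>
  Multilinearity on lists of every length, so that no lengths have to be tracked inside nested
  sums. The functions that come from cochains vanish on lists of the wrong length.
\<close>

definition mlin :: "('a list \<Rightarrow> 'm) \<Rightarrow> bool" where
  "mlin F \<longleftrightarrow> (\<forall>us vs. lin (\<lambda>x. F (us @ x # vs)))"

lemma mlinI: "(\<And>us vs. lin (\<lambda>x. F (us @ x # vs))) \<Longrightarrow> mlin F"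
  by (simp add: mlin_def)

lemma mlin_lin:
  assumes "mlin F" "linA g"
  shows "lin (\<lambda>x. F (g x # vs))" "lin (\<lambda>x. F (y # g x # vs))" "lin (\<lambda>x. F (us @ g x # vs))"
    "lin (\<lambda>x. F (us @ y # g x # vs))" "lin (\<lambda>x. F (us @ y # z # g x # vs))"
    "lin (\<lambda>x. F (y # us @ g x # vs))"
proof -
  have *: "lin (\<lambda>x. F (ws @ g x # vs))" for ws
    using assms(1) by (intro lin_comp[OF _ assms(2), of "\<lambda>x. F (ws @ x # vs)"]) (simp add: mlin_def)
  show "lin (\<lambda>x. F (g x # vs))" "lin (\<lambda>x. F (y # g x # vs))" "lin (\<lambda>x. F (us @ g x # vs))"
    "lin (\<lambda>x. F (us @ y # g x # vs))" "lin (\<lambda>x. F (us @ y # z # g x # vs))"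
    "lin (\<lambda>x. F (y # us @ g x # vs))"
    using *[of "[]"] *[of "[y]"] *[of us] *[of "us @ [y]"] *[of "us @ [y, z]"] *[of "y # us"]
    by simp_all
qed

lemma linA_prod_list:
  assumes "linA g"
  shows "linA (\<lambda>x. prod_list (us @ g x # vs))" "linA (\<lambda>x. prod_list (g x # vs))"
    "linA (\<lambda>x. prod_list (y # us @ g x # vs))"
  using assms by (simp_all, intro linA_mult_left linA_mult_right, assumption)+

lemma lin_lsw_inner: "(\<And>us vs. lin (\<lambda>z. B z us vs)) \<Longrightarrow> lin (\<lambda>z. lsw xs (B z))"
proof (induction xs arbitrary: B)
  case (Cons x xs)
  have "lin (\<lambda>z. sw x (\<lambda>u v. lsw xs (\<lambda>us vs. B z (u # us) (v # vs))))"
    by (intro lin_sw_inner Cons)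
  thus ?case by simp
qed simp

lemma lsw_cong:
  "(\<And>us vs. length us = length xs \<Longrightarrow> length vs = length xs \<Longrightarrow> B us vs = C us vs) \<Longrightarrow> lsw xs B = lsw xs C"
proof (induction xs arbitrary: B C)
  case (Cons x xs)
  have "lsw xs (\<lambda>us vs. B (u # us) (v # vs)) = lsw xs (\<lambda>us vs. C (u # us) (v # vs))" for u v
    by (intro Cons.IH Cons.prems) simp_all
  thus ?case by simp
qed simp

lemma lsw_append: "lsw (xs @ ys) B = lsw xs (\<lambda>us vs. lsw ys (\<lambda>us' vs'. B (us @ us') (vs @ vs')))"
  by (induction xs arbitrary: B) simp_all

lemma lsw_linear: "Vector_Spaces.linear s s h \<Longrightarrow> h (lsw xs B) = lsw xs (\<lambda>us vs. h (B us vs))"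
  by (induction xs arbitrary: B) (simp_all add: sw_linear)

lemmas lsw_scale = lsw_linear[OF linear_scaling]

lemma sw_add: "sw a (\<lambda>x y. B x y + C x y) = sw a B + sw a C"
  unfolding sw_def tensor_lift_def by (rule linear_ext_add_fun)

lemma lsw_add: "lsw xs (\<lambda>us vs. B us vs + C us vs) = lsw xs B + lsw xs C"
  by (induction xs arbitrary: B C) (simp_all add: sw_add)

lemma lsw_zero: "lsw xs (\<lambda>us vs. 0) = 0"
  using lsw_scale[of 0 xs] by simp

lemma lsw_sum: "lsw xs (\<lambda>us vs. \<Sum>i\<in>I. B i us vs) = (\<Sum>i\<in>I. lsw xs (B i))"
  by (induction I rule: infinite_finite_induct) (simp_all add: lsw_zero lsw_add)

lemma lsw_sw_swap: "lsw xs (\<lambda>us vs. sw a (\<lambda>x y. C us vs x y)) = sw a (\<lambda>x y. lsw xs (\<lambda>us vs. C us vs x y))"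
proof (induction xs arbitrary: C)
  case (Cons x xs)
  show ?case unfolding lsw.simps Cons by (rule sw_swap)
qed simp

definition bimlin :: "('a list \<Rightarrow> 'a list \<Rightarrow> 'm) \<Rightarrow> bool" where
  "bimlin B \<longleftrightarrow> (\<forall>vs. mlin (\<lambda>us. B us vs)) \<and> (\<forall>us. mlin (\<lambda>vs. B us vs))"

lemma bimlinI: "(\<And>vs. mlin (\<lambda>us. B us vs)) \<Longrightarrow> (\<And>us. mlin (\<lambda>vs. B us vs)) \<Longrightarrow> bimlin B"
  by (simp add: bimlin_def)

lemma mlin_lsw:
  assumes B: "bimlin B"
  shows "mlin (\<lambda>xs. lsw xs B)"
proof (rule mlinI)
  fix us vs
  note B' = B[unfolded bimlin_def]
  note B1 = B'[THEN conjunct1, rule_format, THEN mlin_lin(3)]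
    and B2 = B'[THEN conjunct2, rule_format, THEN mlin_lin(3)]
  show "lin (\<lambda>x. lsw (us @ x # vs) B)"
    unfolding lsw_append lsw.simps
    by (intro lin_lsw_inner lin_intros B1 B2)
qed

lemma lsw_coassoc:
  assumes "\<And>q r. mlin (\<lambda>p. T p q r)" "\<And>p r. mlin (\<lambda>q. T p q r)" "\<And>p q. mlin (\<lambda>r. T p q r)"
  shows "lsw xs (\<lambda>us vs. lsw us (\<lambda>p q. T p q vs)) = lsw xs (\<lambda>us vs. lsw vs (\<lambda>p q. T us p q))"
  using assms
proof (induction xs arbitrary: T)
  case (Cons x xs)
  note T = Cons.prems[THEN mlin_lin(1)]
  have T': "mlin (\<lambda>p. T (a # p) q r)" "mlin (\<lambda>q. T p (a # q) r)" "mlin (\<lambda>r. T p q (a # r))" for a p q r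
    using Cons.prems[THEN mlin_lin(6)] by (auto intro!: mlinI simp: linA_id)
  have "lsw (x # xs) (\<lambda>us vs. lsw us (\<lambda>p q. T p q vs))
      = sw x (\<lambda>u v. sw u (\<lambda>u1 u2. lsw xs (\<lambda>us vs. lsw us (\<lambda>p q. T (u1 # p) (u2 # q) (v # vs)))))"
    by (simp add: lsw_sw_swap)
  also have "\<dots> = sw x (\<lambda>u v. sw v (\<lambda>v1 v2. lsw xs (\<lambda>us vs. lsw us (\<lambda>p q. T (u # p) (v1 # q) (v2 # vs)))))"
    by (rule sw_coassoc) (intro lin_intros lin_lsw_inner T)
  also have "\<dots> = sw x (\<lambda>u v. sw v (\<lambda>v1 v2. lsw xs (\<lambda>us vs. lsw vs (\<lambda>p q. T (u # us) (v1 # p) (v2 # q)))))"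
    by (subst Cons.IH) (simp_all add: T')
  also have "\<dots> = lsw (x # xs) (\<lambda>us vs. lsw vs (\<lambda>p q. T us p q))"
    by (simp add: lsw_sw_swap)
  finally show ?case .
qed simp

text \<open>
  Multiplicativity of \<open>\<Delta>\<close>: the product of the entries behaves like a single element.
\<close>

lemma lsw_prod_list:
  assumes "bilin B"
  shows "lsw xs (\<lambda>us vs. B (prod_list us) (prod_list vs)) = sw (prod_list xs) B"
  using assms
proof (induction xs arbitrary: B)
  case (Cons x xs)
  note li = lin_intros lin2[OF Cons.prems]
  have "lsw (x # xs) (\<lambda>us vs. B (prod_list us) (prod_list vs))
      = sw x (\<lambda>u v. lsw xs (\<lambda>us vs. B (u * prod_list us) (v * prod_list vs)))"
    by simp
  also have "\<dots> = sw x (\<lambda>u v. sw (prod_list xs) (\<lambda>p q. B (u * p) (v * q)))"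
    by (subst Cons.IH[where B = "\<lambda>p q. B (_ * p) (_ * q)"]) (intro li, rule refl)
  also have "\<dots> = sw (prod_list (x # xs)) B"
    by (simp add: sw_mult[OF Cons.prems])
  finally show ?case .
qed (simp add: sw_one)

lemma lsw_counit:
  assumes "mlin F"
  shows "lsw xs (\<lambda>us vs. s (\<epsilon> (prod_list vs)) (F us)) = F xs"
  using assms
proof (induction xs arbitrary: F)
  case (Cons x xs)
  have F: "mlin (\<lambda>us. F (u # us))" for u
    using mlin_lin(6)[OF Cons.prems linA_id] by (auto intro: mlinI)
  have "lsw (x # xs) (\<lambda>us vs. s (\<epsilon> (prod_list vs)) (F us))
      = sw x (\<lambda>u v. s (\<epsilon> v) (lsw xs (\<lambda>us vs. s (\<epsilon> (prod_list vs)) (F (u # us)))))"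
    by (simp add: counit_mult lsw_scale)
  also have "\<dots> = sw x (\<lambda>u v. s (\<epsilon> v) (F (u # xs)))"
    by (simp add: Cons.IH[OF F])
  also have "\<dots> = F (x # xs)"
    by (rule sw_counit_right) (intro mlin_lin(1)[OF Cons.prems] linA_id)
  finally show ?case .
qed (simp add: counit_one)

lemma lin_sw3_inner: "(\<And>x y z. lin (\<lambda>w. T w x y z)) \<Longrightarrow> lin (\<lambda>w. sw3 a (T w))"
  unfolding sw3_def by (intro lin_sw_inner)

lemma lin_sw3_arg:
  assumes "trilin T" "linA g"
  shows "lin (\<lambda>x. sw3 (g x) T)"
  unfolding sw3_def by (intro lin_intros lin3[OF assms(1)] assms(2))

lemma sw3_linear: "Vector_Spaces.linear s s h \<Longrightarrow> h (sw3 a T) = sw3 a (\<lambda>x y z. h (T x y z))"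
  by (simp add: sw3_def sw_linear)

lemma sw3_sw_swap: "sw3 a (\<lambda>x y z. sw b (\<lambda>u v. C x y z u v)) = sw b (\<lambda>u v. sw3 a (\<lambda>x y z. C x y z u v))"
  unfolding sw3_def by (subst (2) sw_swap, subst sw_swap) (rule refl)

lemma sw3_lsw_swap: "sw3 a (\<lambda>x y z. lsw xs (\<lambda>us vs. C x y z us vs)) = lsw xs (\<lambda>us vs. sw3 a (\<lambda>x y z. C x y z us vs))"
  unfolding sw3_def lsw_sw_swap ..

text \<open>
  Multiplicativity of \<open>\<Delta>\<close> for one adjacent pair of entries.
\<close>

lemma lsw_merge:
  assumes B: "bimlin B" and i: "i + 1 < length xs"
  shows "lsw (merge i xs) B = lsw xs (\<lambda>us vs. B (merge i us) (merge i vs))"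
proof -
  define ps p q qs where "ps = take i xs" "p = xs ! i" "q = xs ! (i + 1)" "qs = drop (i + 2) xs"
  have xs: "xs = ps @ p # q # qs" and ps: "length ps = i"
    using i by (simp_all add: ps_p_q_qs_def Cons_nth_drop_Suc One_nat_def)
  have m: "merge i (us @ a # b # vs) = us @ (a * b) # vs" if "length us = i" for us a b vs
    using that by (simp add: merge_def nth_append One_nat_def)
  note B' = B[unfolded bimlin_def]
  note B1 = B'[THEN conjunct1, rule_format, THEN mlin_lin(3)]
    and B2 = B'[THEN conjunct2, rule_format, THEN mlin_lin(3)]
  have "lsw (merge i xs) B = lsw ps (\<lambda>us vs. sw (p * q) (\<lambda>u v. lsw qs (\<lambda>us' vs'. B (us @ u # us') (vs @ v # vs'))))"
    by (simp add: xs m ps lsw_append)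
  also have "\<dots> = lsw ps (\<lambda>us vs. sw p (\<lambda>a b. sw q (\<lambda>c d. lsw qs (\<lambda>us' vs'. B (us @ (a * c) # us') (vs @ (b * d) # vs')))))"
    by (subst sw_mult) (intro lin_intros lin_lsw_inner B1 B2, rule refl)
  also have "\<dots> = lsw xs (\<lambda>us vs. B (merge i us) (merge i vs))"
    unfolding xs lsw_append lsw.simps by (rule lsw_cong) (simp add: m ps)
  finally show ?thesis .
qed

text \<open>
  The operators of the two complexes change a few adjacent entries at a fixed position \<open>k\<close>. The
  variable entry lies before, in, or after this block.
\<close>

lemma multilinear_blockI:
  assumes l: "k + l \<le> m"
    and A: "\<And>us vs bs qs. length us + 1 + length vs = k \<Longrightarrow> length bs = l \<Longrightarrow> length qs = m - k - l
      \<Longrightarrow> lin (\<lambda>x. E ((us @ x # vs) @ bs @ qs))"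
    and B: "\<And>ps us vs qs. length ps = k \<Longrightarrow> length us + 1 + length vs = l \<Longrightarrow> length qs = m - k - l
      \<Longrightarrow> lin (\<lambda>x. E (ps @ (us @ x # vs) @ qs))"
    and C: "\<And>ps bs us vs. length ps = k \<Longrightarrow> length bs = l \<Longrightarrow> length us + 1 + length vs = m - k - l
      \<Longrightarrow> lin (\<lambda>x. E (ps @ bs @ (us @ x # vs)))"
  shows "multilinear (hscale H) s m E"
  unfolding multilinear_def
proof (intro allI impI)
  fix us vs :: "'a list" assume m: "length us + 1 + length vs = m"
  consider "length us < k" | "k \<le> length us" "length us < k + l" | "k + l \<le> length us" by linarith
  thus "lin (\<lambda>x. E (us @ x # vs))"
  proof cases
    case 1
    define j where "j = k - length us - 1"
    have "lin (\<lambda>x. E ((us @ x # take j vs) @ take l (drop j vs) @ drop l (drop j vs)))"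
      by (rule A) (use 1 l m in \<open>auto simp: j_def\<close>)
    thus ?thesis by (simp only: append_take_drop_id append_assoc append_Cons)
  next
    case 2
    define j where "j = k + l - length us - 1"
    have "lin (\<lambda>x. E (take k us @ (drop k us @ x # take j vs) @ drop j vs))"
      by (rule B) (use 2 l m in \<open>auto simp: j_def\<close>)
    moreover have "take k us @ (drop k us @ x # take j vs) @ drop j vs = us @ x # vs" for x
      by (metis append.assoc append_Cons append_take_drop_id)
    ultimately show ?thesis by (simp only:)
  next
    case 3
    have "lin (\<lambda>x. E (take k us @ take l (drop k us) @ (drop l (drop k us) @ x # vs)))"
      by (rule C) (use 3 l m in auto)
    moreover have "take k us @ take l (drop k us) @ (drop l (drop k us) @ x # vs) = us @ x # vs" for x
      by (metis append.assoc append_take_drop_id)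
    ultimately show ?thesis by (simp only:)
  qed
qed

section \<open>The operators of the two complexes on multilinear functions\<close>

text \<open>
  These four functions are what \<open>twist\<close>, \<open>twist_last\<close>, \<open>sym_d\<close> and \<open>hoch_d\<close> become when a linear
  map \<open>f\<close> is replaced by the multilinear function \<open>F\<close> of its values on pure tensors.
\<close>

definition twist_fun :: "nat \<Rightarrow> ('a list \<Rightarrow> 'm) \<Rightarrow> 'a list \<Rightarrow> 'm" where
  "twist_fun i F xs = sw3 (xs ! i) (\<lambda>u v w. F (take (i - 1) xs
     @ [xs ! (i - 1) * u, S v, w * xs ! (i + 1)] @ drop (i + 2) xs))"

definition twist_last_fun :: "nat \<Rightarrow> ('a list \<Rightarrow> 'm) \<Rightarrow> 'a list \<Rightarrow> 'm" where
  "twist_last_fun n F xs = sw (xs ! n) (\<lambda>u v. F (take (n - 1) xs @ [xs ! (n - 1) * u, S v]))"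

definition sym_d_fun :: "nat \<Rightarrow> ('a list \<Rightarrow> 'm) \<Rightarrow> 'a list \<Rightarrow> 'm" where
  "sym_d_fun n F xs = (\<Sum>i<n. s ((-1) ^ i) (F (merge i xs)))
     + s ((-1) ^ n * \<epsilon> (xs ! n)) (F (take n xs))"

definition hoch_d_fun :: "nat \<Rightarrow> ('a list \<Rightarrow> 'm) \<Rightarrow> 'a list \<Rightarrow> 'm" where
  "hoch_d_fun n F xs = (\<Sum>i\<le>n. s ((-1) ^ i) (F (merge i xs)))"

lemma twist_fun_block:
  assumes "i = length ps + 1"
  shows "twist_fun i F (ps @ p # q # r # qs) = sw3 q (\<lambda>u v w. F (ps @ (p * u) # S v # (w * r) # qs))"
  using assms by (simp add: twist_fun_def nth_append)

lemma twist_last_fun_block: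
  assumes "n = length ps + 1"
  shows "twist_last_fun n F (ps @ [p, q]) = sw q (\<lambda>u v. F (ps @ [p * u, S v]))"
  using assms by (simp add: twist_last_fun_def nth_append)

lemma merge_block: "i = length ps \<Longrightarrow> merge i (ps @ p # q # qs) = ps @ (p * q) # qs"
  by (simp add: merge_def nth_append One_nat_def)

lemma multilinear_twist_fun:
  assumes F: "mlin F" and i: "1 \<le> i" "i + 2 \<le> m"
  shows "multilinear (hscale H) s m (twist_fun i F)"
proof (rule multilinear_blockI[where k = "i - 1" and l = 3])
  note li = lin_intros lin_sw3_inner lin_sw3_arg mlin_lin[OF F]
  have F': "lin (\<lambda>x. F (ps @ p # q # r # us @ g x # vs))" if "linA g" for ps p q r us vs g
    using mlin_lin(3)[OF F that, of "ps @ p # q # r # us" vs] by simp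
  show "lin (\<lambda>x. twist_fun i F ((us @ x # vs) @ bs @ qs))"
    if *: "length us + 1 + length vs = i - 1" "length bs = 3" for us vs bs qs :: "'a list"
  proof -
    obtain p q r where bs: "bs = [p, q, r]"
      using *(2) by (auto simp: numeral_3_eq_3 length_Suc_conv)
    have "twist_fun i F ((us @ x # vs) @ bs @ qs)
        = sw3 q (\<lambda>u v w. F (us @ x # vs @ (p * u) # S v # (w * r) # qs))" for x
      using twist_fun_block[of i "us @ x # vs" F p q r qs] *(1) i by (simp add: bs One_nat_def)
    thus ?thesis by (auto intro!: li)
  qed
  show "lin (\<lambda>x. twist_fun i F (ps @ (us @ x # vs) @ qs))"
    if *: "length ps = i - 1" "length us + 1 + length vs = 3" for ps us vs qs :: "'a list"
  proof -
    have ps: "i = length ps + 1" using *(1) i by simp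
    consider q r where "us = []" "vs = [q, r]" | p r where "us = [p]" "vs = [r]"
      | p q where "us = [p, q]" "vs = []"
    proof -
      have "length us = 0 \<and> length vs = 2 \<or> length us = 1 \<and> length vs = 1 \<or> length us = 2 \<and> length vs = 0"
        using *(2) by linarith
      thus ?thesis using that by (auto simp: length_Suc_conv numeral_2_eq_2 One_nat_def)
    qed
    thus ?thesis
      by cases (simp_all add: twist_fun_block[OF ps], (intro li)+)
  qed
  show "lin (\<lambda>x. twist_fun i F (ps @ bs @ us @ x # vs))"
    if *: "length ps = i - 1" "length bs = 3" for ps bs us vs :: "'a list"
  proof -
    have ps: "i = length ps + 1" using *(1) i by simp
    obtain p q r where bs: "bs = [p, q, r]"
      using *(2) by (auto simp: numeral_3_eq_3 length_Suc_conv)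
    show ?thesis unfolding bs by (simp add: twist_fun_block[OF ps]) (intro li F')
  qed
qed (use i in auto)

lemma multilinear_twist_last_fun:
  assumes F: "mlin F" and n: "1 \<le> n"
  shows "multilinear (hscale H) s (n + 1) (twist_last_fun n F)"
proof (rule multilinear_blockI[where k = "n - 1" and l = 2])
  note li = lin_intros mlin_lin[OF F]
  show "lin (\<lambda>x. twist_last_fun n F ((us @ x # vs) @ bs @ qs))"
    if *: "length us + 1 + length vs = n - 1" "length bs = 2" "length qs = n + 1 - (n - 1) - 2" for us vs bs qs :: "'a list"
  proof -
    obtain p q where bs: "bs = [p, q]" "qs = []"
      using *(2,3) n by (auto simp: numeral_2_eq_2 length_Suc_conv)
    have "twist_last_fun n F ((us @ x # vs) @ bs @ qs)
        = sw q (\<lambda>u v. F (us @ x # vs @ [p * u, S v]))" for x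
      using twist_last_fun_block[of n "us @ x # vs" F p q] *(1) n by (simp add: bs One_nat_def)
    thus ?thesis by (auto intro!: li)
  qed
  show "lin (\<lambda>x. twist_last_fun n F (ps @ (us @ x # vs) @ qs))"
    if *: "length ps = n - 1" "length us + 1 + length vs = 2" "length qs = n + 1 - (n - 1) - 2" for ps us vs qs :: "'a list"
  proof -
    have ps: "n = length ps + 1" using *(1) n by simp
    have qs: "qs = []" using *(3) n by simp
    consider q where "us = []" "vs = [q]" | p where "us = [p]" "vs = []"
      using *(2) by (cases us; cases vs) (auto simp: One_nat_def)
    thus ?thesis
      by cases (simp_all add: qs twist_last_fun_block[OF ps], (intro li)+)
  qed
qed (use n in auto)

lemma multilinear_merge:
  assumes F: "mlin F" and i: "i + 2 \<le> m"
  shows "multilinear (hscale H) s m (\<lambda>xs. F (merge i xs))"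
proof (rule multilinear_blockI[where k = i and l = 2])
  note li = lin_intros mlin_lin[OF F]
  have F': "lin (\<lambda>x. F (ps @ p # us @ g x # vs))" if "linA g" for ps p us vs g
    using mlin_lin(3)[OF F that, of "ps @ p # us" vs] by simp
  show "lin (\<lambda>x. F (merge i ((us @ x # vs) @ bs @ qs)))"
    if *: "length us + 1 + length vs = i" "length bs = 2" for us vs bs qs :: "'a list"
  proof -
    obtain p q where bs: "bs = [p, q]"
      using *(2) by (auto simp: numeral_2_eq_2 length_Suc_conv)
    have "merge i ((us @ x # vs) @ bs @ qs) = us @ x # vs @ (p * q) # qs" for x
      using merge_block[of i "us @ x # vs" p q qs] *(1) by (simp add: bs)
    thus ?thesis by (auto intro!: li)
  qed
  show "lin (\<lambda>x. F (merge i (ps @ (us @ x # vs) @ qs)))"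
    if *: "length ps = i" "length us + 1 + length vs = 2" for ps us vs qs :: "'a list"
  proof -
    consider q where "us = []" "vs = [q]" | p where "us = [p]" "vs = []"
      using *(2) by (cases us; cases vs) (auto simp: One_nat_def)
    thus ?thesis
      by cases (simp_all add: merge_block *(1)[symmetric], (intro li)+)
  qed
  show "lin (\<lambda>x. F (merge i (ps @ bs @ us @ x # vs)))"
    if *: "length ps = i" "length bs = 2" for ps bs us vs :: "'a list"
  proof -
    obtain p q where bs: "bs = [p, q]"
      using *(2) by (auto simp: numeral_2_eq_2 length_Suc_conv)
    show ?thesis unfolding bs by (simp add: merge_block *(1)[symmetric]) (intro li F')
  qed
qed (use i in auto)

lemma multilinear_take_counit:
  assumes F: "mlin F"
  shows "multilinear (hscale H) s (n + 1) (\<lambda>xs. s (\<epsilon> (xs ! n)) (F (take n xs)))"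
  unfolding multilinear_def
proof (intro allI impI)
  fix us vs :: "'a list" assume l: "length us + 1 + length vs = n + 1"
  show "lin (\<lambda>x. s (\<epsilon> ((us @ x # vs) ! n)) (F (take n (us @ x # vs))))"
  proof (cases vs rule: rev_cases)
    case Nil
    thus ?thesis using l by (simp add: nth_append lin_scale_counit linA_id)
  next
    case (snoc ws y)
    have "(us @ x # vs) ! n = y" "take n (us @ x # vs) = us @ x # ws" for x
      using l by (auto simp: snoc nth_append One_nat_def nth_Cons')
    thus ?thesis by (simp add: lin_scaled mlin_lin[OF F] linA_id)
  qed
qed

lemma multilinear_add:
  "multilinear (hscale H) s m E \<Longrightarrow> multilinear (hscale H) s m E' \<Longrightarrow> multilinear (hscale H) s m (\<lambda>xs. E xs + E' xs)"
  by (simp add: multilinear_def lin_plus)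

lemma multilinear_scaled: "multilinear (hscale H) s m E \<Longrightarrow> multilinear (hscale H) s m (\<lambda>xs. s c (E xs))"
  by (simp add: multilinear_def lin_scaled)

lemma multilinear_uminus: "multilinear (hscale H) s m E \<Longrightarrow> multilinear (hscale H) s m (\<lambda>xs. - E xs)"
  by (simp add: multilinear_def lin_uminus)

lemma multilinear_sums:
  "(\<And>i. i \<in> I \<Longrightarrow> multilinear (hscale H) s m (E i)) \<Longrightarrow> multilinear (hscale H) s m (\<lambda>xs. \<Sum>i\<in>I. E i xs)"
  by (simp add: multilinear_def lin_sums)

lemma multilinear_sym_d_fun:
  assumes F: "mlin F"
  shows "multilinear (hscale H) s (n + 1) (sym_d_fun n F)"
  unfolding sym_d_fun_def[abs_def] scale_scale[symmetric]
  by (intro multilinear_add multilinear_sums multilinear_scaled multilinear_merge multilinear_take_counit F) auto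

section \<open>Linear maps on tensor powers as multilinear functions\<close>

abbreviation maps :: "nat \<Rightarrow> (('a list \<Rightarrow>\<^sub>0 'k) set \<Rightarrow> 'm) set" where
  "maps n \<equiv> linear_maps (tensor_space (hscale H) n) s"

abbreviation tclass :: "nat \<Rightarrow> ('a list \<Rightarrow>\<^sub>0 'k) \<Rightarrow> ('a list \<Rightarrow>\<^sub>0 'k) set" where
  "tclass \<equiv> tensor_class (hscale H)"

text \<open>
  The value \<open>0\<close> on lists of other lengths makes the function of a linear map multilinear on lists of
  every length.
\<close>

definition on_pure :: "nat \<Rightarrow> (('a list \<Rightarrow>\<^sub>0 'k) set \<Rightarrow> 'm) \<Rightarrow> 'a list \<Rightarrow> 'm" where
  "on_pure n g xs = (if length xs = n then g (tclass n (pure xs)) else 0)"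

definition induced :: "nat \<Rightarrow> ('a list \<Rightarrow> 'm) \<Rightarrow> ('a list \<Rightarrow>\<^sub>0 'k) set \<Rightarrow> 'm" where
  "induced n F = restrict0 (tensors (hscale H) n) (tensor_lift s F)"

lemma linear_map_class:
  assumes "g \<in> maps n" "f \<in> homogeneous n"
  shows "g (tclass n f) = linear_ext s (on_pure n g) f"
  unfolding linear_maps_class[OF assms]
  by (rule linear_ext_cong) (use assms(2) in \<open>auto simp: on_pure_def homogeneous_def\<close>)

lemma mlin_on_pure:
  assumes g: "g \<in> maps n"
  shows "mlin (on_pure n g)"
proof (intro mlinI linI)
  fix us vs x y c
  show "on_pure n g (us @ (x + y) # vs) = on_pure n g (us @ x # vs) + on_pure n g (us @ y # vs)"
  proof (cases "length us + 1 + length vs = n")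
    case True
    let ?p = "\<lambda>z. pure (us @ z # vs)"
    have h: "?p z \<in> homogeneous n" for z using True by (simp add: homogeneous_single One_nat_def)
    have "?p (x + y) - (?p x + ?p y) \<in> tensor_rel (hscale H) n"
      unfolding tensor_rel_def diff_diff_eq[symmetric]
      by (rule free.span_base) (use True in force)
    from tensor_class_eqI[OF this] show ?thesis
      using linear_map_class[OF g h[of "x + y"]] linear_map_class[OF g homogeneous_add[OF h[of x] h[of y]]]
      by (simp add: linear_ext_add)
  qed (auto simp: on_pure_def One_nat_def)
  show "on_pure n g (us @ hscale H c x # vs) = s c (on_pure n g (us @ x # vs))"
  proof (cases "length us + 1 + length vs = n")
    case True
    let ?p = "\<lambda>z. Poly_Mapping.single (us @ z # vs)"
    have h: "?p z d \<in> homogeneous n" for z d using True by (simp add: homogeneous_single One_nat_def)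
    have "?p (hscale H c x) 1 - ?p x c \<in> tensor_rel (hscale H) n"
      unfolding tensor_rel_def
      by (rule free.span_base) (use True in force)
    from tensor_class_eqI[OF this] show ?thesis
      using linear_map_class[OF g h[of "hscale H c x" 1]] linear_map_class[OF g h[of x c]] by simp
  qed (auto simp: on_pure_def One_nat_def)
qed

lemma mlin_multilinear: "mlin F \<Longrightarrow> multilinear (hscale H) s n F"
  by (simp add: mlin_def multilinear_def)

lemma induced_in_maps:
  assumes F: "multilinear (hscale H) s n F"
  shows "induced n F \<in> maps n"
  by (auto simp: linear_maps_def induced_def restrict0_def tensors_eq vadd_tensor_class vscale_tensor_class
      tensor_lift_class[OF F] linear_ext_add linear_ext_scale homogeneous_add homogeneous_scale)

lemma on_pure_induced:
  "multilinear (hscale H) s n F \<Longrightarrow> length xs = n \<Longrightarrow> on_pure n (induced n F) xs = F xs"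
  by (simp add: on_pure_def induced_def restrict0_def tensor_class_in homogeneous_single tensor_lift_class)

lemma tensor_lift_cong:
  assumes "t \<in> tensors (hscale H) n" "\<And>xs. length xs = n \<Longrightarrow> F xs = G xs"
  shows "tensor_lift s F t = tensor_lift s G t"
  unfolding tensor_lift_def
  by (rule linear_ext_cong) (use tensor_representative(1)[OF assms(1)] assms(2) in \<open>auto simp: homogeneous_def\<close>)

lemma induced_cong: "(\<And>xs. length xs = n \<Longrightarrow> F xs = G xs) \<Longrightarrow> induced n F = induced n G"
  by (auto simp: induced_def restrict0_def intro!: ext tensor_lift_cong)

lemma linear_map_eq_lift:
  assumes "g \<in> maps n" "t \<in> tensors (hscale H) n"
  shows "g t = tensor_lift s (on_pure n g) t"
  using linear_map_class[OF assms(1) tensor_representative(1)[OF assms(2)]]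
  by (simp add: tensor_lift_def tensor_representative(2)[OF assms(2)])

lemma induced_on_pure: "g \<in> maps n \<Longrightarrow> induced n (on_pure n g) = g"
  by (auto simp: induced_def restrict0_def linear_map_eq_lift[symmetric] linear_maps_def intro!: ext)

text \<open>
  The operators of the two complexes apply a free-space valued function \<open>K\<close> to a chosen
  representative of a tensor. As \<open>g\<close> is linear, its value on the result is computed term by term,
  even before it is known that \<open>K\<close> respects the relations.
\<close>

lemma linear_map_free_lift:
  assumes g: "g \<in> maps n" and t: "t \<in> tensors (hscale H) m"
    and K: "\<And>xs. length xs = m \<Longrightarrow> K xs \<in> homogeneous n"
    and E: "\<And>xs. length xs = m \<Longrightarrow> linear_ext s (on_pure n g) (K xs) = E xs"
  shows "g (tclass n (free_lift K t)) = tensor_lift s E t"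
proof -
  have "free_lift K t \<in> homogeneous n"
    unfolding tensor_lift_def
    by (rule homogeneous_linear_ext) (use tensor_representative(1)[OF t] K in \<open>auto simp: homogeneous_def\<close>)
  hence "g (tclass n (free_lift K t)) = tensor_lift s (\<lambda>xs. linear_ext s (on_pure n g) (K xs)) t"
    by (simp add: linear_map_class[OF g] linear_ext_free_lift)
  also have "\<dots> = tensor_lift s E t"
    by (rule tensor_lift_cong[OF t E])
  finally show ?thesis .
qed

text \<open>
  Used to turn the conditions of linearity over the Hopf algebra, which speak of all tensors, into
  conditions on lists.
\<close>

lemma tensor_lift_eq_iff:
  assumes "multilinear (hscale H) s m E" "multilinear (hscale H) s m E'"
  shows "(\<forall>t\<in>tensors (hscale H) m. tensor_lift s E t = tensor_lift s E' t)
    \<longleftrightarrow> (\<forall>xs. length xs = m \<longrightarrow> E xs = E' xs)"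
proof
  assume *: "\<forall>t\<in>tensors (hscale H) m. tensor_lift s E t = tensor_lift s E' t"
  show "\<forall>xs. length xs = m \<longrightarrow> E xs = E' xs"
  proof (intro allI impI)
    fix xs :: "'a list" assume "length xs = m"
    from *[rule_format, OF tensor_class_in[OF homogeneous_single[OF this]], of 1]
    show "E xs = E' xs" by (simp add: tensor_lift_class assms)
  qed
qed (auto intro: tensor_lift_cong)

lemma tensor_lift_linear: "Vector_Spaces.linear s s h \<Longrightarrow> h (tensor_lift s E t) = tensor_lift s (\<lambda>xs. h (E xs)) t"
  unfolding tensor_lift_def by (rule linear_linear_ext)

lemma multilinear_linear_comp:
  assumes "Vector_Spaces.linear s s h" "multilinear (hscale H) s m E"
  shows "multilinear (hscale H) s m (\<lambda>xs. h (E xs))"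
  using assms(2) Vector_Spaces.linear_compose[OF _ assms(1), of "hscale H"]
  by (auto simp: multilinear_def o_def)

lemma multilinear_left:
  assumes F: "mlin F"
  shows "multilinear (hscale H) s m (\<lambda>xs. F ((b * hd xs) # tl xs))"
  unfolding multilinear_def
proof (intro allI impI)
  fix us vs
  show "lin (\<lambda>x. F ((b * hd (us @ x # vs)) # tl (us @ x # vs)))"
    by (cases us) (auto intro!: lin_intros mlin_lin[OF F])
qed

lemma multilinear_right:
  assumes F: "mlin F"
  shows "multilinear (hscale H) s m (\<lambda>xs. F (butlast xs @ [last xs * c]))"
  unfolding multilinear_def
proof (intro allI impI)
  fix us vs
  show "lin (\<lambda>x. F (butlast (us @ x # vs) @ [last (us @ x # vs) * c]))"
  proof (cases vs rule: rev_cases)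
    case Nil
    thus ?thesis by (auto intro!: lin_intros mlin_lin[OF F])
  next
    case (snoc ws y)
    have "butlast (us @ x # vs) = us @ x # ws" "last (us @ x # vs) = y" for x
      using butlast_snoc[of "us @ x # ws" y] last_snoc[of "us @ x # ws" y] by (simp_all add: snoc)
    thus ?thesis by (auto intro!: lin_intros mlin_lin[OF F])
  qed
qed

lemma left_mult_lift:
  assumes "g \<in> maps m" "t \<in> tensors (hscale H) m" "m > 0"
  shows "g (left_mult H m b t) = tensor_lift s (\<lambda>xs. on_pure m g ((b * hd xs) # tl xs)) t"
  unfolding left_mult_def
  by (rule linear_map_free_lift[OF assms(1,2)]) (use assms(3) in \<open>auto intro!: homogeneous_single\<close>)

lemma right_mult_lift:
  assumes "g \<in> maps m" "t \<in> tensors (hscale H) m" "m > 0"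
  shows "g (right_mult H m t c) = tensor_lift s (\<lambda>xs. on_pure m g (butlast xs @ [last xs * c])) t"
  unfolding right_mult_def
  by (rule linear_map_free_lift[OF assms(1,2)]) (use assms(3) in \<open>auto intro!: homogeneous_single simp: One_nat_def\<close>)

lemma twist_lift:
  assumes g: "g \<in> maps m" and t: "t \<in> tensors (hscale H) m" and i: "1 \<le> i" "i + 2 \<le> m"
  shows "g (twist H m i t) = tensor_lift s (twist_fun i (on_pure m g)) t"
  unfolding twist_def
proof (rule linear_map_free_lift[OF g t])
  fix xs :: "'a list" assume l: "length xs = m"
  let ?z = "\<lambda>u v w. take (i - 1) xs @ [xs ! (i - 1) * u, S v, w * xs ! (i + 1)] @ drop (i + 2) xs"
  have len: "length (?z u v w) = m" for u v w
    using l i by (simp add: One_nat_def)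
  show "free_lift (\<lambda>ys. pure (?z (ys ! 0) (ys ! 1) (ys ! 2))) (coprod3 H (xs ! i)) \<in> homogeneous m"
    unfolding tensor_lift_def by (intro homogeneous_linear_ext homogeneous_single len)
  have "trilin (\<lambda>u v w. on_pure m g (?z u v w))"
    by simp (intro lin_intros mlin_lin[OF mlin_on_pure[OF g]])
  from coprod3_lift[OF this]
  show "linear_ext s (on_pure m g) (free_lift (\<lambda>ys. pure (?z (ys ! 0) (ys ! 1) (ys ! 2))) (coprod3 H (xs ! i)))
      = twist_fun i (on_pure m g) xs"
    by (simp add: linear_ext_free_lift twist_fun_def sw3_def)
qed

lemma twist_last_lift:
  assumes g: "g \<in> maps (n + 1)" and t: "t \<in> tensors (hscale H) (n + 1)" and n: "1 \<le> n"
  shows "g (twist_last H (n + 1) t) = tensor_lift s (twist_last_fun n (on_pure (n + 1) g)) t"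
  unfolding twist_last_def
proof (rule linear_map_free_lift[OF g t])
  have n2: "n + 1 - 2 = n - 1" "n + 1 - 1 = n" by simp_all
  fix xs :: "'a list" assume l: "length xs = n + 1"
  let ?z = "\<lambda>u v. take (n + 1 - 2) xs @ [xs ! (n + 1 - 2) * u, S v]"
  have len: "length (?z u v) = n + 1" for u v
    using l n by (simp add: One_nat_def)
  show "free_lift (\<lambda>ys. pure (?z (ys ! 0) (ys ! 1))) (coprod H (xs ! (n + 1 - 1))) \<in> homogeneous (n + 1)"
    unfolding tensor_lift_def by (intro homogeneous_linear_ext homogeneous_single len)
  show "linear_ext s (on_pure (n + 1) g) (free_lift (\<lambda>ys. pure (?z (ys ! 0) (ys ! 1))) (coprod H (xs ! (n + 1 - 1))))
      = twist_last_fun n (on_pure (n + 1) g) xs"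
    unfolding n2 by (simp add: linear_ext_free_lift twist_last_fun_def sw_def)
qed

lemma length_merge: "i + 1 < length xs \<Longrightarrow> length (merge i xs) = length xs - 1"
  by (simp add: merge_def)

lemma sym_delta_eq:
  assumes "g \<in> maps (n + 1)"
  shows "sym_delta H n g = induced (n + 2) (sym_d_fun (n + 1) (on_pure (n + 1) g))"
proof -
  have "g (sym_d H (n + 1) t) = tensor_lift s (sym_d_fun (n + 1) (on_pure (n + 1) g)) t"
    if "t \<in> tensors (hscale H) (n + 2)" for t
    unfolding sym_d_def
  proof (rule linear_map_free_lift[OF assms that], goal_cases)
    case (1 xs)
    show ?case
      by (intro homogeneous_add homogeneous_sum homogeneous_scale homogeneous_single)
        (use 1 in \<open>auto simp: length_merge\<close>)
  next
    case (2 xs)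
    show ?case by (simp add: linear_ext_add linear_ext_sum linear_ext_scale sym_d_fun_def)
  qed
  thus ?thesis by (simp add: sym_delta_def induced_def restrict0_def fun_eq_iff)
qed

lemma hoch_delta_eq:
  assumes "g \<in> maps (n + 2)"
  shows "hoch_delta H n g = induced (n + 3) (hoch_d_fun (n + 1) (on_pure (n + 2) g))"
proof -
  have n: "n + 1 + 1 = n + 2" by simp
  have "g (hoch_d H (n + 1) t) = tensor_lift s (hoch_d_fun (n + 1) (on_pure (n + 2) g)) t"
    if "t \<in> tensors (hscale H) (n + 3)" for t
    unfolding hoch_d_def n
  proof (rule linear_map_free_lift[OF assms that], goal_cases)
    case (1 xs)
    show ?case
      by (intro homogeneous_sum homogeneous_scale homogeneous_single)
        (use 1 in \<open>auto simp: length_merge\<close>)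
  next
    case (2 xs)
    show ?case by (simp add: linear_ext_sum linear_ext_scale hoch_d_fun_def)
  qed
  thus ?thesis by (simp add: hoch_delta_def induced_def restrict0_def fun_eq_iff)
qed

lemma tensor_lift_uminus: "- tensor_lift s E t = tensor_lift s (\<lambda>xs. - E xs) t"
  by (simp add: tensor_lift_def linear_ext_def sum_negf)

definition sym_twist_fun :: "nat \<Rightarrow> nat \<Rightarrow> ('a list \<Rightarrow> 'm) \<Rightarrow> 'a list \<Rightarrow> 'm" where
  "sym_twist_fun n i F = (if i < n then twist_fun i F else twist_last_fun n F)"

lemma multilinear_sym_twist_fun:
  "mlin F \<Longrightarrow> 1 \<le> i \<Longrightarrow> i \<le> n \<Longrightarrow> multilinear (hscale H) s (n + 1) (sym_twist_fun n i F)"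
  by (simp add: sym_twist_fun_def multilinear_twist_fun multilinear_twist_last_fun)

lemma sym_sigma_eq:
  assumes "g \<in> maps (n + 1)" "1 \<le> i" "i \<le> n"
  shows "sym_sigma H n i g = induced (n + 1) (\<lambda>xs. - sym_twist_fun n i (on_pure (n + 1) g) xs)"
  using twist_lift[OF assms(1) _ assms(2)] twist_last_lift[OF assms(1)] assms(2,3)
  by (auto simp: sym_sigma_def induced_def restrict0_def fun_eq_iff sym_twist_fun_def
      tensor_lift_uminus[symmetric])

lemma hoch_sigma_eq:
  assumes "g \<in> maps (n + 2)" "1 \<le> i" "i \<le> n"
  shows "hoch_sigma H n i g = induced (n + 2) (\<lambda>xs. - twist_fun i (on_pure (n + 2) g) xs)"
  using twist_lift[OF assms(1) _ assms(2)] assms(3)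
  by (auto simp: hoch_sigma_def induced_def restrict0_def fun_eq_iff tensor_lift_uminus[symmetric])

end

section \<open>Invariants and quotients\<close>

text \<open>
  The transpositions generate the symmetric group, so that invariance under all operators that
  compute the action of some permutation reduces to invariance under the \<open>\<sigma> i\<close>.
\<close>

lemma sym_invariants_iff:
  "f \<in> sym_invariants n \<sigma> C \<longleftrightarrow> f \<in> C \<and> (\<forall>i. 1 \<le> i \<longrightarrow> i \<le> n \<longrightarrow> \<sigma> i f = f)"
proof (intro iffI conjI allI impI)
  assume f: "f \<in> sym_invariants n \<sigma> C"
  thus "f \<in> C" by (simp add: sym_invariants_def)
  fix i assume i: "1 \<le> i" "i \<le> n"
  have "transpose i (i + 1) \<circ> id permutes {1..n + 1}"
    using i by (simp add: permutes_swap_id)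
  with f perm_step[OF perm_id i, of \<sigma>] show "\<sigma> i f = f"
    unfolding sym_invariants_def by force
next
  assume f: "f \<in> C \<and> (\<forall>i. 1 \<le> i \<longrightarrow> i \<le> n \<longrightarrow> \<sigma> i f = f)"
  have "F f = f" if "perm_acts n \<sigma> \<pi> F" for \<pi> F
    using that by induction (use f in auto)
  with f show "f \<in> sym_invariants n \<sigma> C" by (auto simp: sym_invariants_def)
qed

text \<open>
  A coset is mapped to its image under \<open>\<phi>\<close>, so that no representatives are chosen. To recover the
  coset, \<open>\<psi>\<close> has to invert \<open>\<phi>\<close> on its elements \<open>v + w\<close>, and hence on \<open>V\<close> and on \<open>W\<close>.
\<close>

lemma quotient_space_isoI:
  fixes \<phi> :: "'u::ab_group_add \<Rightarrow> 'v::ab_group_add" and \<psi> :: "'v \<Rightarrow> 'u"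
  assumes \<phi>: "\<And>x y. \<phi> (x + y) = \<phi> x + \<phi> y" and \<psi>: "\<And>x y. \<psi> (x + y) = \<psi> x + \<psi> y"
    and scale: "\<And>c x. \<phi> (s c x) = s' c (\<phi> x)"
    and V: "\<phi> ` V = V'" and W: "\<phi> ` W = W'"
    and inv: "\<And>x. x \<in> V \<Longrightarrow> \<psi> (\<phi> x) = x" "\<And>x. x \<in> W \<Longrightarrow> \<psi> (\<phi> x) = x"
  shows "quotient_space s V W \<cong>\<^sub>k quotient_space s' V' W'"
proof -
  have plus: "\<phi> ` (X + Y) = \<phi> ` X + \<phi> ` Y" for X Y
    by (force simp: set_plus_def \<phi>)
  have coset: "\<phi> ` (v +o W) = \<phi> v +o W'" for v
    by (force simp: elt_set_plus_def \<phi> W[symmetric])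
  have inj: "inj_on ((`) \<phi>) ((\<lambda>v. v +o W) ` V)"
  proof (rule inj_on_inverseI[where g = "(`) \<psi>"])
    fix X assume "X \<in> (\<lambda>v. v +o W) ` V"
    hence "\<And>x. x \<in> X \<Longrightarrow> \<psi> (\<phi> x) = x"
      by (auto simp: elt_set_plus_def \<phi> \<psi> inv)
    thus "\<psi> ` \<phi> ` X = X" by (simp add: image_image)
  qed
  have "bij_betw ((`) \<phi>) ((\<lambda>v. v +o W) ` V) ((\<lambda>v. v +o W') ` V')"
    unfolding bij_betw_def using inj by (simp add: image_image coset V[symmetric])
  moreover have "\<phi> ` coset_scale s W c X = coset_scale s' W' c (\<phi> ` X)" for c X
    by (simp add: coset_scale_def plus W image_image scale)
  ultimately show ?thesis
    unfolding vspace_iso_def quotient_space_def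
    by (intro exI[of _ "(`) \<phi>"]) (simp add: plus)
qed

section \<open>The comparison of cochains\<close>

locale bimodule_cochains = cocommutative_hopf_algebra H + hopf_bimodule H M
  for H :: "('k::field, 'a::ring_1) hopf" and M :: "('k, 'a, 'm::ab_group_add) bimodule"
begin

sublocale sweedler H "mscale M"
  by (intro sweedler.intro cocommutative_hopf_algebra_axioms mscale_vector_space)

abbreviation "s \<equiv> mscale M"
abbreviation "L \<equiv> lact M"
abbreviation "R \<equiv> ract M"

lemma lin_ract: "linA g \<Longrightarrow> lin (\<lambda>x. R m (g x))"
  by (rule linI) (simp_all add: lin_add lin_scale ract_add_right ract_scale_right)

lemma lin_lact: "linA g \<Longrightarrow> lin (\<lambda>x. L (g x) m)"
  by (rule linI) (simp_all add: lin_add lin_scale lact_add_left lact_scale_left)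

lemma lin_ract_left: "lin f \<Longrightarrow> lin (\<lambda>x. R (f x) a)"
  by (rule linI) (simp_all add: lin_add[of "hscale H" s] lin_scale[of "hscale H" s] ract_add_left ract_scale_left)

lemma lin_lact_right: "lin f \<Longrightarrow> lin (\<lambda>x. L a (f x))"
  by (rule linI) (simp_all add: lin_add[of "hscale H" s] lin_scale[of "hscale H" s] lact_add_right lact_scale_right)

lemma linear_lact: "Vector_Spaces.linear s s (L a)"
  unfolding Vector_Spaces.linear_iff by (simp add: mscale_vector_space lact_add_right lact_scale_right)

lemma linear_ract: "Vector_Spaces.linear s s (\<lambda>m. R m a)"
  unfolding Vector_Spaces.linear_iff by (simp add: mscale_vector_space ract_add_left ract_scale_left)

lemma linear_lact_ract: "Vector_Spaces.linear s s (\<lambda>m. R (L a m) b)"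
  unfolding Vector_Spaces.linear_iff
  by (simp add: mscale_vector_space ract_add_left ract_scale_left lact_add_right lact_scale_right)

lemmas bimodule_lin_intros = lin_intros lin_ract lin_lact lin_ract_left lin_lact_right
  lin_lsw_inner lin_sw3_inner lin_sw3_arg bimlinI mlinI linA_prod_list quadlinI

text \<open>
  The action of \<open>ad H M\<close>.
\<close>

definition adjoint :: "'a \<Rightarrow> 'm \<Rightarrow> 'm" where
  "adjoint b m = sw b (\<lambda>x y. R (L x m) (S y))"

lemma lact_ad: "lact (ad H M) = adjoint"
  by (simp add: ad_def adjoint_def[abs_def] sw_def)

lemma mscale_ad: "mscale (ad H M) = s"
  by (simp add: ad_def)

text \<open>
  The maps \<open>\<Psi>\<close> and \<open>\<Phi>\<close> of the introduction, on the level of multilinear functions.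
\<close>

definition to_hoch :: "('a list \<Rightarrow> 'm) \<Rightarrow> 'a list \<Rightarrow> 'm" where
  "to_hoch F xs = lsw (butlast xs) (\<lambda>us vs. R (F us) (prod_list vs * last xs))"

definition to_sym :: "('a list \<Rightarrow> 'm) \<Rightarrow> 'a list \<Rightarrow> 'm" where
  "to_sym G xs = lsw xs (\<lambda>us vs. R (G (us @ [1])) (S (prod_list vs)))"

lemma to_hoch_snoc: "to_hoch F (xs @ [y]) = lsw xs (\<lambda>us vs. R (F us) (prod_list vs * y))"
  by (simp add: to_hoch_def)

lemma mlin_to_sym:
  assumes G: "mlin G"
  shows "mlin (to_sym G)"
proof -
  have G1: "lin (\<lambda>x. G ((us @ g x # vs) @ [1]))" if "linA g" for us vs g
    using mlin_lin(3)[OF G that, of us "vs @ [1]"] by simp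
  show ?thesis
    unfolding to_sym_def[abs_def] by (intro mlin_lsw bimodule_lin_intros G1)
qed

lemma mlin_to_hoch:
  assumes F: "mlin F"
  shows "mlin (to_hoch F)"
proof (rule mlinI)
  fix us vs
  show "lin (\<lambda>x. to_hoch F (us @ x # vs))"
  proof (cases vs rule: rev_cases)
    case Nil
    thus ?thesis by (simp add: to_hoch_snoc) (intro bimodule_lin_intros)
  next
    case (snoc ws y)
    have "mlin (\<lambda>xs. to_hoch F (xs @ [y]))"
      unfolding to_hoch_snoc by (intro mlin_lsw bimodule_lin_intros mlin_lin[OF F])
    from mlin_lin(3)[OF this linA_id] show ?thesis by (simp add: snoc)
  qed
qed

text \<open>
  The two legs of the product of the entries meet as \<open>p\<^sup>(\<^sup>1\<^sup>) S(p\<^sup>(\<^sup>2\<^sup>))\<close>.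
\<close>

lemma to_sym_to_hoch:
  assumes F: "mlin F"
  shows "to_sym (to_hoch F) xs = F xs"
proof -
  have "to_sym (to_hoch F) xs = lsw xs (\<lambda>us vs. lsw us (\<lambda>ps qs. R (F ps) (prod_list qs * S (prod_list vs))))"
    by (simp add: to_sym_def to_hoch_snoc lsw_linear[OF linear_ract] ract_mult)
  also have "\<dots> = lsw xs (\<lambda>ps vs. lsw vs (\<lambda>us vs. R (F ps) (prod_list us * S (prod_list vs))))"
    by (rule lsw_coassoc) (intro bimodule_lin_intros mlin_lin[OF F])+
  also have "\<dots> = lsw xs (\<lambda>ps vs. sw (prod_list vs) (\<lambda>x y. R (F ps) (x * S y)))"
    by (subst lsw_prod_list[where B = "\<lambda>x y. R _ (x * S y)"]) (intro bimodule_lin_intros, rule refl)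
  also have "\<dots> = lsw xs (\<lambda>ps vs. s (\<epsilon> (prod_list vs)) (F ps))"
    by (subst sw_antipode_right) (intro bimodule_lin_intros, simp add: ract_one)
  also have "\<dots> = F xs" by (rule lsw_counit[OF F])
  finally show ?thesis .
qed

text \<open>
  The two legs of the product of the entries meet as \<open>S(p\<^sup>(\<^sup>1\<^sup>)) p\<^sup>(\<^sup>2\<^sup>)\<close>. Right linearity moves the
  result into the last argument of \<open>G\<close>.
\<close>

lemma to_hoch_to_sym:
  assumes G: "mlin G" and right: "\<And>us. length us = length xs \<Longrightarrow> G (us @ [y]) = R (G (us @ [1])) y"
  shows "to_hoch (to_sym G) (xs @ [y]) = G (xs @ [y])"
proof -
  have G1: "lin (\<lambda>x. G ((us @ g x # vs) @ [z]))" if "linA g" for us vs g z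
    using mlin_lin(3)[OF G that, of us "vs @ [z]"] by simp
  have "to_hoch (to_sym G) (xs @ [y])
      = lsw xs (\<lambda>us vs. lsw us (\<lambda>ps qs. R (G (ps @ [1])) (S (prod_list qs) * prod_list vs * y)))"
    by (simp add: to_sym_def to_hoch_snoc lsw_linear[OF linear_ract] ract_mult)
  also have "\<dots> = lsw xs (\<lambda>ps vs. lsw vs (\<lambda>us vs. R (G (ps @ [1])) (S (prod_list us) * prod_list vs * y)))"
    by (rule lsw_coassoc) (intro bimodule_lin_intros G1)+
  also have "\<dots> = lsw xs (\<lambda>ps vs. sw (prod_list vs) (\<lambda>p q. R (G (ps @ [1])) (S p * q * y)))"
    by (subst lsw_prod_list[where B = "\<lambda>p q. R _ (S p * q * y)"]) (intro bimodule_lin_intros, rule refl)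
  also have "\<dots> = lsw xs (\<lambda>ps vs. s (\<epsilon> (prod_list vs)) (R (G (ps @ [1])) y))"
    by (subst sw_antipode_left[where h = "\<lambda>p. R _ (p * y)"]) (intro bimodule_lin_intros, simp)
  also have "\<dots> = lsw xs (\<lambda>ps vs. s (\<epsilon> (prod_list vs)) (G (ps @ [y])))"
    by (rule lsw_cong) (simp add: right)
  also have "\<dots> = G (xs @ [y])"
    by (rule lsw_counit[of "\<lambda>ps. G (ps @ [y])"]) (intro mlinI G1 linA_id)
  finally show ?thesis .
qed

subsection \<open>Linearity over the Hopf algebra\<close>

text \<open>
  The identity \<open>b\<^sup>(\<^sup>1\<^sup>) m S(b\<^sup>(\<^sup>2\<^sup>)) b\<^sup>(\<^sup>3\<^sup>) z = b m z\<close>.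
\<close>

lemma adjoint_shift: "sw b (\<lambda>p q. R (adjoint p m) (q * z)) = L b (R m z)"
proof -
  have "sw b (\<lambda>p q. R (adjoint p m) (q * z)) = sw b (\<lambda>p q. sw p (\<lambda>x y. R (L x m) (S y * q * z)))"
    by (simp add: adjoint_def sw_linear[OF linear_ract] ract_mult)
  also have "\<dots> = sw b (\<lambda>x w. sw w (\<lambda>y q. R (L x m) (S y * q * z)))"
    by (rule sw_coassoc) (intro bimodule_lin_intros)
  also have "\<dots> = sw b (\<lambda>x w. s (\<epsilon> w) (R (L x m) z))"
    by (subst sw_antipode_left[where h = "\<lambda>p. R _ (p * z)"]) (intro bimodule_lin_intros, simp)
  also have "\<dots> = R (L b m) z"
    by (rule sw_counit_right) (intro bimodule_lin_intros)
  finally show ?thesis by (simp add: lact_ract)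
qed

lemma to_hoch_left:
  assumes F: "mlin F"
    and left: "\<And>b u us. length us = length xs \<Longrightarrow> F ((b * u) # us) = adjoint b (F (u # us))"
  shows "to_hoch F ((b * x) # xs @ [y]) = L b (to_hoch F (x # xs @ [y]))"
proof -
  note li = bimodule_lin_intros mlin_lin[OF F]
  have "to_hoch F ((b * x) # xs @ [y])
      = sw (b * x) (\<lambda>u v. lsw xs (\<lambda>us vs. R (F (u # us)) (v * prod_list vs * y)))"
    using to_hoch_snoc[of F "(b * x) # xs"] by simp
  also have "\<dots> = sw b (\<lambda>p q. sw x (\<lambda>u v. lsw xs (\<lambda>us vs. R (F ((p * u) # us)) (q * v * prod_list vs * y))))"
    by (rule sw_mult) (intro li)
  also have "\<dots> = sw b (\<lambda>p q. sw x (\<lambda>u v. lsw xs (\<lambda>us vs. R (adjoint p (F (u # us))) (q * (v * prod_list vs * y)))))"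
    by (intro arg_cong[of _ _ "sw _"] ext lsw_cong) (simp add: left mult.assoc)
  also have "\<dots> = sw x (\<lambda>u v. lsw xs (\<lambda>us vs. sw b (\<lambda>p q. R (adjoint p (F (u # us))) (q * (v * prod_list vs * y)))))"
    by (subst sw_swap) (simp add: lsw_sw_swap)
  also have "\<dots> = L b (to_hoch F (x # xs @ [y]))"
    using to_hoch_snoc[of F "x # xs"] by (simp add: adjoint_shift sw_linear[OF linear_lact] lsw_linear[OF linear_lact])
  finally show ?thesis .
qed

lemma to_hoch_right: "to_hoch F (xs @ [y * c]) = R (to_hoch F (xs @ [y])) c"
  by (simp add: to_hoch_snoc lsw_linear[OF linear_ract] ract_mult)

lemma to_sym_left:
  assumes G: "mlin G"
    and left: "\<And>b u us. length us = length xs \<Longrightarrow> G ((b * u) # us @ [1]) = L b (G (u # us @ [1]))"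
  shows "to_sym G ((b * x) # xs) = adjoint b (to_sym G (x # xs))"
proof -
  note li = bimodule_lin_intros mlin_lin[OF G]
  have anti: "R m (S (q * z)) = R (R m (S z)) (S q)" for m q z
    using antipode_mult[of "R m" q z] lin_ract[OF linA_id, of m] by (simp add: ract_mult)
  have "to_sym G ((b * x) # xs)
      = sw b (\<lambda>p q. sw x (\<lambda>u v. lsw xs (\<lambda>us vs. R (G ((p * u) # us @ [1])) (S (q * v * prod_list vs)))))"
    unfolding to_sym_def lsw.simps append_Cons prod_list.Cons by (rule sw_mult) (intro li)
  also have "\<dots> = sw b (\<lambda>p q. sw x (\<lambda>u v. lsw xs (\<lambda>us vs. R (L p (R (G (u # us @ [1])) (S (v * prod_list vs)))) (S q))))"
    by (intro arg_cong[of _ _ "sw _"] ext lsw_cong) (simp add: left mult.assoc lact_ract anti[of _ _ "_ * _"])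
  also have "\<dots> = adjoint b (to_sym G (x # xs))"
    by (simp add: adjoint_def to_sym_def sw_linear[OF linear_lact_ract] lsw_linear[OF linear_lact_ract])
  finally show ?thesis .
qed

subsection \<open>The differentials\<close>

lemma merge_snoc:
  "i + 1 < length xs \<Longrightarrow> merge i (xs @ [y]) = merge i xs @ [y]"
  "i + 1 = length ws + 1 \<Longrightarrow> merge i (ws @ [z, y]) = ws @ [z * y]"
  by (simp_all add: merge_def nth_append)

lemma prod_list_merge: "i + 1 < length xs \<Longrightarrow> prod_list (merge i xs) = prod_list xs"
proof -
  assume i: "i + 1 < length xs"
  have "prod_list xs = prod_list (take i xs @ xs ! i # xs ! (i + 1) # drop (i + 2) xs)"
    using i by (simp add: Cons_nth_drop_Suc One_nat_def flip: prod_list.append)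
  thus ?thesis by (simp add: merge_def mult.assoc)
qed

text \<open>
  The summands with \<open>i < n\<close> correspond to each other one by one. In the last one, the counit on the
  symmetric side leaves only the second leg of the last factor, which is multiplied into \<open>y\<close> just as
  \<open>merge n\<close> does it on the Hochschild side.
\<close>

lemma to_hoch_d:
  assumes F: "mlin F" and l: "length zs = n + 1"
  shows "to_hoch (sym_d_fun n F) (zs @ [y]) = hoch_d_fun n (to_hoch F) (zs @ [y])"
proof -
  note li = bimodule_lin_intros mlin_lin[OF F]
  obtain ws z where zs: "zs = ws @ [z]" and ws: "length ws = n"
    using l by (cases zs rule: rev_cases) (auto simp: One_nat_def)
  have inner: "lsw zs (\<lambda>us vs. R (F (merge i us)) (prod_list vs * y)) = to_hoch F (merge i (zs @ [y]))"
    if "i < n" for i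
  proof -
    have "to_hoch F (merge i (zs @ [y])) = lsw (merge i zs) (\<lambda>us vs. R (F us) (prod_list vs * y))"
      using that l by (simp add: merge_snoc to_hoch_snoc)
    also have "\<dots> = lsw zs (\<lambda>us vs. R (F (merge i us)) (prod_list (merge i vs) * y))"
      by (rule lsw_merge) (use that l in \<open>auto intro!: li\<close>)
    also have "\<dots> = lsw zs (\<lambda>us vs. R (F (merge i us)) (prod_list vs * y))"
      by (rule lsw_cong) (use that l in \<open>simp add: prod_list_merge\<close>)
    finally show ?thesis by simp
  qed
  have last: "lsw zs (\<lambda>us vs. R (s (\<epsilon> (us ! n)) (F (take n us))) (prod_list vs * y))
      = to_hoch F (merge n (zs @ [y]))"
  proof -
    have "lsw zs (\<lambda>us vs. R (s (\<epsilon> (us ! n)) (F (take n us))) (prod_list vs * y))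
      = lsw ws (\<lambda>us vs. sw z (\<lambda>p q. s (\<epsilon> p) (R (F us) (prod_list vs * q * y))))"
      unfolding zs lsw_append lsw.simps
      by (rule lsw_cong) (simp add: ws nth_append ract_scale_left mult.assoc)
    also have "\<dots> = lsw ws (\<lambda>us vs. R (F us) (prod_list vs * z * y))"
      by (subst sw_counit_left) (intro li, rule refl)
    also have "\<dots> = to_hoch F (merge n (zs @ [y]))"
      by (simp add: zs merge_snoc ws to_hoch_snoc mult.assoc)
    finally show ?thesis .
  qed
  have ract_sum: "R (sum f I) a = (\<Sum>i\<in>I. R (f i) a)" for f :: "nat \<Rightarrow> 'm" and I a
    by (rule lin_sum[OF linear_ract])
  have "to_hoch (sym_d_fun n F) (zs @ [y])
      = (\<Sum>i<n. s ((-1) ^ i) (lsw zs (\<lambda>us vs. R (F (merge i us)) (prod_list vs * y))))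
        + s ((-1) ^ n) (lsw zs (\<lambda>us vs. R (s (\<epsilon> (us ! n)) (F (take n us))) (prod_list vs * y)))"
    by (simp add: to_hoch_snoc sym_d_fun_def ract_add_left ract_sum lsw_add lsw_sum ract_scale_left
        lsw_scale flip: scale_scale)
  also have "\<dots> = hoch_d_fun n (to_hoch F) (zs @ [y])"
    by (simp add: inner last hoch_d_fun_def lessThan_Suc_atMost[symmetric])
  finally show ?thesis .
qed

subsection \<open>The transpositions\<close>

text \<open>
  Both sides are brought to a sum over the coproducts of the entries \<open>ps\<close>, \<open>p\<close>, \<open>r\<close>, \<open>qs\<close>. What is
  left is a statement about the legs of the middle entry \<open>q\<close>, and that is \<open>sw3_cancel\<close> for the
  function \<open>T\<close>, whose last argument \<open>d\<close> is the contribution of \<open>q\<close> to the product on the right.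
\<close>

lemma to_hoch_twist:
  assumes F: "mlin F" and i: "1 \<le> i" "i < n" and l: "length zs = n + 1"
  shows "to_hoch (twist_fun i F) (zs @ [y]) = twist_fun i (to_hoch F) (zs @ [y])"
proof -
  note li = bimodule_lin_intros mlin_lin[OF F]
  have F': "lin (\<lambda>x. F (ps @ p # q # g x # us))" if "linA g" for ps p q us g
    using mlin_lin(3)[OF F that, of "ps @ p # q # []" us] by simp
  define ps p q r qs where "ps = take (i - 1) zs" "p = zs ! (i - 1)" "q = zs ! i" "r = zs ! (i + 1)" "qs = drop (i + 2) zs"
  have zs: "zs = ps @ p # q # r # qs" and ps: "i = length ps + 1"
  proof -
    have "zs = take (i - 1) zs @ drop (i - 1) zs" by simp
    moreover have "drop (i - 1) zs = p # q # r # qs"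
      using i l by (simp add: ps_p_q_r_qs_def Cons_nth_drop_Suc[symmetric] One_nat_def)
    ultimately show "zs = ps @ p # q # r # qs" by (simp add: ps_p_q_r_qs_def)
    show "i = length ps + 1" using i l by (simp add: ps_p_q_r_qs_def One_nat_def)
  qed
  define T where "T a1 a2 p1 p2 a b c d = sw r (\<lambda>r1 r2. lsw qs (\<lambda>c1 c2.
     R (F (a1 @ (p1 * a) # S b # (c * r1) # c1)) (prod_list a2 * (p2 * (d * (r2 * prod_list c2))) * y)))"
    for a1 a2 p1 p2 a b c d
  have T: "quadlin (T a1 a2 p1 p2)" for a1 a2 p1 p2
    unfolding T_def by (intro li F')
  have "to_hoch (twist_fun i F) (zs @ [y])
      = lsw ps (\<lambda>a1 a2. sw p (\<lambda>p1 p2. sw q (\<lambda>q1 q2. sw3 q1 (\<lambda>a b c. T a1 a2 p1 p2 a b c q2))))"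
    unfolding to_hoch_snoc zs lsw_append lsw.simps
    by (rule lsw_cong) (simp add: twist_fun_block ps T_def sw3_linear[OF linear_ract] sw3_sw_swap sw3_lsw_swap)
  also have "\<dots> = lsw ps (\<lambda>a1 a2. sw p (\<lambda>p1 p2. sw3 q (\<lambda>a b c. sw a (\<lambda>a1' a2'. sw b (\<lambda>b1 b2. sw c (\<lambda>c1 c2.
      T a1 a2 p1 p2 a1' b1 c1 (a2' * S b2 * c2)))))))"
    by (simp add: sw3_cancel[OF T])
  also have "\<dots> = sw3 q (\<lambda>a b c. lsw ps (\<lambda>a1 a2. sw p (\<lambda>p1 p2. sw a (\<lambda>a1' a2'. sw b (\<lambda>b1 b2. sw c (\<lambda>c1 c2.
      T a1 a2 p1 p2 a1' b1 c1 (a2' * S b2 * c2)))))))"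
    by (simp add: sw3_lsw_swap sw3_sw_swap)
  also have "\<dots> = sw3 q (\<lambda>a b c. to_hoch F ((ps @ (p * a) # S b # (c * r) # qs) @ [y]))"
  proof -
    have "to_hoch F ((ps @ (p * a) # S b # (c * r) # qs) @ [y])
      = lsw ps (\<lambda>a1 a2. sw p (\<lambda>p1 p2. sw a (\<lambda>a1' a2'. sw b (\<lambda>b1 b2. sw c (\<lambda>c1 c2.
      T a1 a2 p1 p2 a1' b1 c1 (a2' * S b2 * c2))))))" for a b c
      unfolding to_hoch_snoc lsw_append lsw.simps prod_list.append prod_list.Cons prod_list.Nil T_def
      by (subst sw_mult, (intro li F'), subst antipode_coprod, (intro li F'), subst sw_mult, (intro li F'))
         (simp add: mult.assoc)
    thus ?thesis by simp
  qed
  also have "\<dots> = twist_fun i (to_hoch F) (zs @ [y])"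
    using twist_fun_block[OF ps, of "to_hoch F" p q r "qs @ [y]"] by (simp add: zs)
  finally show ?thesis .
qed

text \<open>
  The last transposition moves three factors on the Hochschild side but only two on the symmetric
  side: the third factor there is \<open>y\<close>, which stays in the product on the right, together with the
  leg \<open>c\<close> of \<open>q\<close>.
\<close>

lemma to_hoch_twist_last:
  assumes F: "mlin F" and n: "1 \<le> n" and l: "length zs = n + 1"
  shows "to_hoch (twist_last_fun n F) (zs @ [y]) = twist_fun n (to_hoch F) (zs @ [y])"
proof -
  note li = bimodule_lin_intros mlin_lin[OF F]
  obtain ps p q where zs: "zs = ps @ [p, q]"
  proof -
    obtain ws q where "zs = ws @ [q]" using l by (cases zs rule: rev_cases) auto
    moreover from this obtain ps p where "ws = ps @ [p]" using l n by (cases ws rule: rev_cases) auto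
    ultimately show ?thesis using that by simp
  qed
  have ps: "n = length ps + 1" using l by (simp add: zs One_nat_def)
  define T where "T a1 a2 p1 p2 a b d c = R (F (a1 @ [p1 * a, S b])) (prod_list a2 * (p2 * (d * (c * y))))"
    for a1 a2 p1 p2 a b d c
  have T: "quadlin (T a1 a2 p1 p2)" for a1 a2 p1 p2
    unfolding T_def by (intro li)
  have "to_hoch (twist_last_fun n F) (zs @ [y])
      = lsw ps (\<lambda>a1 a2. sw p (\<lambda>p1 p2. sw3 q (\<lambda>a b c. T a1 a2 p1 p2 a b 1 c)))"
    unfolding to_hoch_snoc zs lsw_append lsw.simps
    by (rule lsw_cong) (simp add: twist_last_fun_block ps T_def sw_linear[OF linear_ract] sw3_def mult.assoc)
  also have "\<dots> = lsw ps (\<lambda>a1 a2. sw p (\<lambda>p1 p2. sw3 q (\<lambda>a b c. sw a (\<lambda>a1' a2'. sw b (\<lambda>b1 b2.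
      T a1 a2 p1 p2 a1' b1 (a2' * S b2) c)))))"
    by (simp add: sw3_cancel_pair[OF T])
  also have "\<dots> = sw3 q (\<lambda>a b c. lsw ps (\<lambda>a1 a2. sw p (\<lambda>p1 p2. sw a (\<lambda>a1' a2'. sw b (\<lambda>b1 b2.
      T a1 a2 p1 p2 a1' b1 (a2' * S b2) c)))))"
    by (simp add: sw3_lsw_swap sw3_sw_swap)
  also have "\<dots> = sw3 q (\<lambda>a b c. to_hoch F ((ps @ [p * a, S b]) @ [c * y]))"
  proof -
    have "to_hoch F ((ps @ [p * a, S b]) @ [c * y])
      = lsw ps (\<lambda>a1 a2. sw p (\<lambda>p1 p2. sw a (\<lambda>a1' a2'. sw b (\<lambda>b1 b2.
      T a1 a2 p1 p2 a1' b1 (a2' * S b2) c))))" for a b c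
      unfolding to_hoch_snoc lsw_append lsw.simps prod_list.append prod_list.Cons prod_list.Nil T_def
      by (subst sw_mult, (intro li), subst antipode_coprod, (intro li)) (simp add: mult.assoc)
    thus ?thesis by simp
  qed
  also have "\<dots> = twist_fun n (to_hoch F) (zs @ [y])"
    using twist_fun_block[OF ps, of "to_hoch F" p q y "[]"] by (simp add: zs)
  finally show ?thesis .
qed

lemma linear_adjoint: "Vector_Spaces.linear s s (adjoint b)"
  unfolding Vector_Spaces.linear_iff adjoint_def
  by (simp add: mscale_vector_space lact_add_right ract_add_left sw_add lact_scale_right ract_scale_left sw_scale)

lemma all_nonempty_lists: "(\<forall>xs. length xs = n + 1 \<longrightarrow> P xs) \<longleftrightarrow> (\<forall>x xs. length xs = n \<longrightarrow> P (x # xs))"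
  by (auto simp: One_nat_def length_Suc_conv)

lemma all_nonempty_lists_snoc: "(\<forall>xs. length xs = n + 1 \<longrightarrow> P xs) \<longleftrightarrow> (\<forall>xs y. length xs = n \<longrightarrow> P (xs @ [y]))"
  by (auto simp: One_nat_def length_Suc_conv_rev)

text \<open>
  One statement for both complexes, with \<open>act\<close> the adjoint or the left action.
\<close>

lemma left_linear_iff:
  assumes g: "g \<in> maps (n + 1)" and act: "Vector_Spaces.linear s s (act b)"
  shows "(\<forall>t\<in>tensors (hscale H) (n + 1). g (left_mult H (n + 1) b t) = act b (g t))
    \<longleftrightarrow> (\<forall>x xs. length xs = n \<longrightarrow> on_pure (n + 1) g ((b * x) # xs) = act b (on_pure (n + 1) g (x # xs)))"
proof -
  note F = mlin_on_pure[OF g]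
  have "(\<forall>t\<in>tensors (hscale H) (n + 1). g (left_mult H (n + 1) b t) = act b (g t))
    \<longleftrightarrow> (\<forall>t\<in>tensors (hscale H) (n + 1). tensor_lift s (\<lambda>xs. on_pure (n + 1) g ((b * hd xs) # tl xs)) t
        = tensor_lift s (\<lambda>xs. act b (on_pure (n + 1) g xs)) t)"
    by (intro ball_cong) (simp_all add: left_mult_lift[OF g] linear_map_eq_lift[OF g] tensor_lift_linear[OF act])
  also have "\<dots> \<longleftrightarrow> (\<forall>xs. length xs = n + 1 \<longrightarrow> on_pure (n + 1) g ((b * hd xs) # tl xs) = act b (on_pure (n + 1) g xs))"
    by (rule tensor_lift_eq_iff[OF multilinear_left[OF F]
        multilinear_linear_comp[OF act mlin_multilinear[OF F]]])
  finally show ?thesis unfolding all_nonempty_lists by simp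
qed

lemma right_linear_iff:
  assumes g: "g \<in> maps (n + 1)"
  shows "(\<forall>t\<in>tensors (hscale H) (n + 1). g (right_mult H (n + 1) t c) = R (g t) c)
    \<longleftrightarrow> (\<forall>xs y. length xs = n \<longrightarrow> on_pure (n + 1) g (xs @ [y * c]) = R (on_pure (n + 1) g (xs @ [y])) c)"
proof -
  note F = mlin_on_pure[OF g]
  have "(\<forall>t\<in>tensors (hscale H) (n + 1). g (right_mult H (n + 1) t c) = R (g t) c)
    \<longleftrightarrow> (\<forall>t\<in>tensors (hscale H) (n + 1). tensor_lift s (\<lambda>xs. on_pure (n + 1) g (butlast xs @ [last xs * c])) t
        = tensor_lift s (\<lambda>xs. R (on_pure (n + 1) g xs) c) t)"
    by (intro ball_cong) (simp_all add: right_mult_lift[OF g] linear_map_eq_lift[OF g] tensor_lift_linear[OF linear_ract])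
  also have "\<dots> \<longleftrightarrow> (\<forall>xs. length xs = n + 1 \<longrightarrow> on_pure (n + 1) g (butlast xs @ [last xs * c]) = R (on_pure (n + 1) g xs) c)"
    by (rule tensor_lift_eq_iff[OF multilinear_right[OF F]
        multilinear_linear_comp[OF linear_ract mlin_multilinear[OF F]]])
  finally show ?thesis unfolding all_nonempty_lists_snoc by simp
qed

lemma sym_C_iff:
  "g \<in> sym_C H (ad H M) n \<longleftrightarrow> g \<in> maps (n + 1) \<and>
     (\<forall>b x xs. length xs = n \<longrightarrow> on_pure (n + 1) g ((b * x) # xs) = adjoint b (on_pure (n + 1) g (x # xs)))"
proof -
  have "g \<in> sym_C H (ad H M) n \<longleftrightarrow> g \<in> maps (n + 1) \<and>
     (\<forall>b. \<forall>t\<in>tensors (hscale H) (n + 1). g (left_mult H (n + 1) b t) = adjoint b (g t))"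
    by (simp add: sym_C_def mscale_ad lact_ad)
  also have "\<dots> \<longleftrightarrow> g \<in> maps (n + 1) \<and>
     (\<forall>b x xs. length xs = n \<longrightarrow> on_pure (n + 1) g ((b * x) # xs) = adjoint b (on_pure (n + 1) g (x # xs)))"
    using left_linear_iff[of g n adjoint, OF _ linear_adjoint] by (intro conj_cong all_cong1 refl)
  finally show ?thesis .
qed

lemma hoch_C_iff:
  "g \<in> hoch_C H M n \<longleftrightarrow> g \<in> maps (n + 2) \<and>
     (\<forall>b x xs. length xs = n + 1 \<longrightarrow> on_pure (n + 2) g ((b * x) # xs) = L b (on_pure (n + 2) g (x # xs))) \<and>
     (\<forall>c xs y. length xs = n + 1 \<longrightarrow> on_pure (n + 2) g (xs @ [y * c]) = R (on_pure (n + 2) g (xs @ [y])) c)"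
proof -
  have n: "n + 1 + 1 = n + 2" by simp
  have "g \<in> hoch_C H M n \<longleftrightarrow> g \<in> maps (n + 2) \<and>
     (\<forall>b. \<forall>t\<in>tensors (hscale H) (n + 2). g (left_mult H (n + 2) b t) = L b (g t)) \<and>
     (\<forall>c. \<forall>t\<in>tensors (hscale H) (n + 2). g (right_mult H (n + 2) t c) = R (g t) c)"
    by (auto simp: hoch_C_def)
  also have "\<dots> \<longleftrightarrow> g \<in> maps (n + 2) \<and>
     (\<forall>b x xs. length xs = n + 1 \<longrightarrow> on_pure (n + 2) g ((b * x) # xs) = L b (on_pure (n + 2) g (x # xs))) \<and>
     (\<forall>c xs y. length xs = n + 1 \<longrightarrow> on_pure (n + 2) g (xs @ [y * c]) = R (on_pure (n + 2) g (xs @ [y])) c)"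
    using left_linear_iff[of g "n + 1" L, OF _ linear_lact, unfolded n] right_linear_iff[of g "n + 1", unfolded n]
    by (intro conj_cong all_cong1 refl)
  finally show ?thesis .
qed

subsection \<open>The isomorphism of complexes\<close>

definition \<Psi> :: "nat \<Rightarrow> (('a list \<Rightarrow>\<^sub>0 'k) set \<Rightarrow> 'm) \<Rightarrow> ('a list \<Rightarrow>\<^sub>0 'k) set \<Rightarrow> 'm" where
  "\<Psi> n g = induced (n + 2) (to_hoch (on_pure (n + 1) g))"

definition \<Phi> :: "nat \<Rightarrow> (('a list \<Rightarrow>\<^sub>0 'k) set \<Rightarrow> 'm) \<Rightarrow> ('a list \<Rightarrow>\<^sub>0 'k) set \<Rightarrow> 'm" where
  "\<Phi> n f = induced (n + 1) (to_sym (on_pure (n + 2) f))"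

lemma \<Psi>_maps: "g \<in> maps (n + 1) \<Longrightarrow> \<Psi> n g \<in> maps (n + 2)"
  unfolding \<Psi>_def by (intro induced_in_maps mlin_multilinear mlin_to_hoch mlin_on_pure)

lemma \<Phi>_maps: "f \<in> maps (n + 2) \<Longrightarrow> \<Phi> n f \<in> maps (n + 1)"
  unfolding \<Phi>_def by (intro induced_in_maps mlin_multilinear mlin_to_sym mlin_on_pure)

lemma on_pure_\<Psi>:
  "g \<in> maps (n + 1) \<Longrightarrow> length xs = n + 2 \<Longrightarrow> on_pure (n + 2) (\<Psi> n g) xs = to_hoch (on_pure (n + 1) g) xs"
  unfolding \<Psi>_def by (intro on_pure_induced mlin_multilinear mlin_to_hoch mlin_on_pure)

lemma on_pure_\<Phi>:
  "f \<in> maps (n + 2) \<Longrightarrow> length xs = n + 1 \<Longrightarrow> on_pure (n + 1) (\<Phi> n f) xs = to_sym (on_pure (n + 2) f) xs"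
  unfolding \<Phi>_def by (intro on_pure_induced mlin_multilinear mlin_to_sym mlin_on_pure)

lemma to_hoch_cong:
  "(\<And>us. length us + 1 = length xs \<Longrightarrow> F us = G us) \<Longrightarrow> xs \<noteq> [] \<Longrightarrow> to_hoch F xs = to_hoch G xs"
  unfolding to_hoch_def by (rule lsw_cong) (simp add: One_nat_def)

lemma to_sym_cong:
  "(\<And>us. length us = length xs + 1 \<Longrightarrow> F us = G us) \<Longrightarrow> to_sym F xs = to_sym G xs"
  unfolding to_sym_def by (rule lsw_cong) simp

lemma \<Phi>_\<Psi>:
  assumes g: "g \<in> maps (n + 1)"
  shows "\<Phi> n (\<Psi> n g) = g"
proof -
  have "\<Phi> n (\<Psi> n g) = induced (n + 1) (on_pure (n + 1) g)"
    unfolding \<Phi>_def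
  proof (rule induced_cong)
    fix xs :: "'a list" assume l: "length xs = n + 1"
    have "to_sym (on_pure (n + 2) (\<Psi> n g)) xs = to_sym (to_hoch (on_pure (n + 1) g)) xs"
      by (rule to_sym_cong, rule on_pure_\<Psi>[OF g]) (simp add: l)
    thus "to_sym (on_pure (n + 2) (\<Psi> n g)) xs = on_pure (n + 1) g xs"
      by (simp add: to_sym_to_hoch mlin_on_pure[OF g])
  qed
  thus ?thesis by (simp only: induced_on_pure[OF g])
qed

text \<open>
  On all linear maps \<open>\<Phi>\<close> is not injective in general, since it reads only the values with last
  factor \<open>1\<close>; right linearity of \<open>f\<close> recovers the others.
\<close>

lemma \<Psi>_\<Phi>:
  assumes f: "f \<in> hoch_C H M n"
  shows "\<Psi> n (\<Phi> n f) = f"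
proof -
  have f': "f \<in> maps (n + 2)"
    and right: "\<And>c xs y. length xs = n + 1 \<Longrightarrow> on_pure (n + 2) f (xs @ [y * c]) = R (on_pure (n + 2) f (xs @ [y])) c"
    using f by (auto simp: hoch_C_iff)
  have "\<Psi> n (\<Phi> n f) = induced (n + 2) (on_pure (n + 2) f)"
    unfolding \<Psi>_def
  proof (rule induced_cong)
    fix xs :: "'a list" assume l: "length xs = n + 2"
    then obtain ws y where xs: "xs = ws @ [y]" and ws: "length ws = n + 1"
      by (cases xs rule: rev_cases) (auto simp: One_nat_def)
    have "to_hoch (on_pure (n + 1) (\<Phi> n f)) xs = to_hoch (to_sym (on_pure (n + 2) f)) xs"
      by (rule to_hoch_cong, rule on_pure_\<Phi>[OF f']) (use l in auto)
    also have "\<dots> = on_pure (n + 2) f xs"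
      unfolding xs by (rule to_hoch_to_sym[OF mlin_on_pure[OF f']]) (use right[of _ 1 y] ws in simp)
    finally show "to_hoch (on_pure (n + 1) (\<Phi> n f)) xs = on_pure (n + 2) f xs" .
  qed
  thus ?thesis by (simp only: induced_on_pure[OF f'])
qed

lemma \<Psi>_hoch_C:
  assumes g: "g \<in> sym_C H (ad H M) n"
  shows "\<Psi> n g \<in> hoch_C H M n"
proof -
  have g': "g \<in> maps (n + 1)"
    and left: "\<And>b x xs. length xs = n \<Longrightarrow> on_pure (n + 1) g ((b * x) # xs) = adjoint b (on_pure (n + 1) g (x # xs))"
    using g by (auto simp: sym_C_iff)
  show ?thesis
    unfolding hoch_C_iff
  proof (intro conjI allI impI \<Psi>_maps[OF g'])
    fix b x c y and xs :: "'a list" assume l: "length xs = n + 1"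
    then obtain ws z where xs: "xs = ws @ [z]" and ws: "length ws = n"
      by (cases xs rule: rev_cases) (auto simp: One_nat_def)
    show "on_pure (n + 2) (\<Psi> n g) ((b * x) # xs) = L b (on_pure (n + 2) (\<Psi> n g) (x # xs))"
      using to_hoch_left[OF mlin_on_pure[OF g'], of ws b x z, OF left] ws l
        on_pure_\<Psi>[OF g', of "(b * x) # xs"] on_pure_\<Psi>[OF g', of "x # xs"]
      by (simp add: xs)
    show "on_pure (n + 2) (\<Psi> n g) (xs @ [y * c]) = R (on_pure (n + 2) (\<Psi> n g) (xs @ [y])) c"
      using on_pure_\<Psi>[OF g', of "xs @ [y * c]"] on_pure_\<Psi>[OF g', of "xs @ [y]"] l
      by (simp add: to_hoch_right)
  qed
qed

lemma \<Phi>_sym_C: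
  assumes f: "f \<in> hoch_C H M n"
  shows "\<Phi> n f \<in> sym_C H (ad H M) n"
proof -
  have f': "f \<in> maps (n + 2)"
    and left: "\<And>b x xs. length xs = n + 1 \<Longrightarrow> on_pure (n + 2) f ((b * x) # xs) = L b (on_pure (n + 2) f (x # xs))"
    using f by (auto simp: hoch_C_iff)
  show ?thesis
    unfolding sym_C_iff
  proof (intro conjI allI impI \<Phi>_maps[OF f'])
    fix b x and xs :: "'a list" assume l: "length xs = n"
    show "on_pure (n + 1) (\<Phi> n f) ((b * x) # xs) = adjoint b (on_pure (n + 1) (\<Phi> n f) (x # xs))"
      using to_sym_left[OF mlin_on_pure[OF f'], of xs b x] left[of "_ @ [1]"] l
        on_pure_\<Phi>[OF f', of "(b * x) # xs"] on_pure_\<Phi>[OF f', of "x # xs"]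
      by simp
  qed
qed

lemma \<Psi>_sym_delta:
  assumes g: "g \<in> maps (n + 1)"
  shows "sym_delta H n g \<in> maps (n + 2)" "\<Psi> (n + 1) (sym_delta H n g) = hoch_delta H n (\<Psi> n g)"
proof -
  note F = mlin_on_pure[OF g]
  have n: "n + 1 + 1 = n + 2" "n + 1 + 2 = n + 3" by simp_all
  note d = multilinear_sym_d_fun[OF F, of "n + 1", unfolded n]
  show "sym_delta H n g \<in> maps (n + 2)"
    unfolding sym_delta_eq[OF g] by (rule induced_in_maps[OF d])
  show "\<Psi> (n + 1) (sym_delta H n g) = hoch_delta H n (\<Psi> n g)"
    unfolding hoch_delta_eq[OF \<Psi>_maps[OF g]] \<Psi>_def[of "n + 1"] n
  proof (rule induced_cong)
    fix xs :: "'a list" assume l: "length xs = n + 3"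
    then obtain zs y where xs: "xs = zs @ [y]" and zs: "length zs = n + 1 + 1"
      by (cases xs rule: rev_cases) (auto simp: One_nat_def)
    have "to_hoch (on_pure (n + 2) (sym_delta H n g)) xs = to_hoch (sym_d_fun (n + 1) (on_pure (n + 1) g)) xs"
      unfolding sym_delta_eq[OF g]
      by (rule to_hoch_cong, rule on_pure_induced[OF d]) (use l in auto)
    also have "\<dots> = hoch_d_fun (n + 1) (to_hoch (on_pure (n + 1) g)) xs"
      unfolding xs by (rule to_hoch_d[OF F zs])
    also have "\<dots> = hoch_d_fun (n + 1) (on_pure (n + 2) (\<Psi> n g)) xs"
      unfolding hoch_d_fun_def
      by (intro sum.cong arg_cong[of _ _ "s _"] on_pure_\<Psi>[OF g, symmetric]) (auto simp: length_merge l)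
    finally show "to_hoch (on_pure (n + 2) (sym_delta H n g)) xs
        = hoch_d_fun (n + 1) (on_pure (n + 2) (\<Psi> n g)) xs" .
  qed
qed

lemma twist_fun_cong:
  assumes "1 \<le> i" "i + 2 \<le> length xs" "\<And>ys. length ys = length xs \<Longrightarrow> F ys = G ys"
  shows "twist_fun i F xs = twist_fun i G xs"
  unfolding twist_fun_def
  by (intro arg_cong[of _ _ "sw3 _"] ext assms(3)) (use assms(1,2) in \<open>simp add: One_nat_def\<close>)

lemma to_hoch_uminus: "to_hoch (\<lambda>xs. - F xs) xs = - to_hoch F xs"
proof -
  have "R (- m) a = s (- 1) (R m a)" for m a
    using ract_scale_left[of "- 1" m a] by simp
  thus ?thesis using lsw_scale[of "- 1"] by (simp add: to_hoch_def)
qed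

lemma \<Psi>_sym_sigma:
  assumes g: "g \<in> maps (n + 1)" and i: "1 \<le> i" "i \<le> n"
  shows "sym_sigma H n i g \<in> maps (n + 1)" "\<Psi> n (sym_sigma H n i g) = hoch_sigma H n i (\<Psi> n g)"
proof -
  note F = mlin_on_pure[OF g]
  note d = multilinear_uminus[OF multilinear_sym_twist_fun[OF F i]]
  show "sym_sigma H n i g \<in> maps (n + 1)"
    unfolding sym_sigma_eq[OF g i] by (rule induced_in_maps[OF d])
  show "\<Psi> n (sym_sigma H n i g) = hoch_sigma H n i (\<Psi> n g)"
    unfolding hoch_sigma_eq[OF \<Psi>_maps[OF g] i] \<Psi>_def[of n "sym_sigma H n i g"]
  proof (rule induced_cong)
    fix xs :: "'a list" assume l: "length xs = n + 2"
    then obtain zs y where xs: "xs = zs @ [y]" and zs: "length zs = n + 1"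
      by (cases xs rule: rev_cases) (auto simp: One_nat_def)
    have "to_hoch (on_pure (n + 1) (sym_sigma H n i g)) xs = - to_hoch (sym_twist_fun n i (on_pure (n + 1) g)) xs"
      unfolding sym_sigma_eq[OF g i] to_hoch_uminus[symmetric]
      by (rule to_hoch_cong, rule on_pure_induced[OF d]) (use l in auto)
    also have "to_hoch (sym_twist_fun n i (on_pure (n + 1) g)) xs = twist_fun i (to_hoch (on_pure (n + 1) g)) xs"
      using i to_hoch_twist[OF F _ _ zs, of i y] to_hoch_twist_last[OF F _ zs, of y]
      by (cases "i = n") (auto simp: sym_twist_fun_def xs)
    also have "\<dots> = twist_fun i (on_pure (n + 2) (\<Psi> n g)) xs"
      by (rule twist_fun_cong[OF i(1)], use i l in simp, rule on_pure_\<Psi>[OF g, symmetric]) (simp add: l)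
    finally show "to_hoch (on_pure (n + 1) (sym_sigma H n i g)) xs
        = - twist_fun i (on_pure (n + 2) (\<Psi> n g)) xs" .
  qed
qed

subsection \<open>Passage to cohomology\<close>

lemma on_pure_add: "on_pure n (f + g) = (\<lambda>xs. on_pure n f xs + on_pure n g xs)"
  by (auto simp: on_pure_def)

lemma on_pure_fun_scale: "on_pure n (fun_scale s c f) = (\<lambda>xs. s c (on_pure n f xs))"
  by (auto simp: on_pure_def fun_scale_def)

lemma induced_add: "induced n (\<lambda>xs. F xs + G xs) = induced n F + induced n G"
  by (auto simp: induced_def restrict0_def tensor_lift_def linear_ext_add_fun)

lemma induced_scale: "induced n (\<lambda>xs. s c (F xs)) = fun_scale s c (induced n F)"
  by (auto simp: induced_def restrict0_def tensor_lift_def linear_ext_scale_fun fun_scale_def)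

lemma \<Psi>_add: "\<Psi> n (f + g) = \<Psi> n f + \<Psi> n g"
  unfolding \<Psi>_def on_pure_add induced_add[symmetric] to_hoch_def[abs_def]
  by (simp add: ract_add_left lsw_add)

lemma \<Phi>_add: "\<Phi> n (f + g) = \<Phi> n f + \<Phi> n g"
  unfolding \<Phi>_def on_pure_add induced_add[symmetric] to_sym_def[abs_def]
  by (simp add: ract_add_left lsw_add)

lemma \<Phi>_scale: "\<Phi> n (fun_scale s c f) = fun_scale s c (\<Phi> n f)"
  unfolding \<Phi>_def on_pure_fun_scale induced_scale[symmetric] to_sym_def[abs_def]
  by (simp add: ract_scale_left lsw_scale)

lemma \<Psi>_zero: "\<Psi> n 0 = 0"
  using \<Psi>_add[of n 0 0] by simp

lemma \<Phi>_zero: "\<Phi> n 0 = 0"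
  using \<Phi>_add[of n 0 0] by simp

lemma sym_CS_maps: "g \<in> sym_CS H (ad H M) n \<Longrightarrow> g \<in> maps (n + 1)"
  by (simp add: sym_CS_def sym_invariants_iff sym_C_iff)

lemma \<Psi>_sym_CS:
  assumes g: "g \<in> sym_CS H (ad H M) n"
  shows "\<Psi> n g \<in> hoch_CS H M n"
  using g \<Psi>_hoch_C \<Psi>_sym_sigma(2)[OF sym_CS_maps[OF g], symmetric]
  by (auto simp: sym_CS_def hoch_CS_def sym_invariants_iff)

lemma \<Psi>_\<Phi>_CS: "f \<in> hoch_CS H M n \<Longrightarrow> \<Psi> n (\<Phi> n f) = f"
  by (simp add: hoch_CS_def sym_invariants_iff \<Psi>_\<Phi>)

text \<open>
  All properties of \<open>\<Phi>\<close> with respect to the transpositions and the differentials follow from those of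
  its inverse.
\<close>

lemma \<Phi>_hoch_CS:
  assumes f: "f \<in> hoch_CS H M n"
  shows "\<Phi> n f \<in> sym_CS H (ad H M) n"
proof -
  from f have fC: "f \<in> hoch_C H M n" and fix_f: "\<And>i. 1 \<le> i \<Longrightarrow> i \<le> n \<Longrightarrow> hoch_sigma H n i f = f"
    by (auto simp: hoch_CS_def sym_invariants_iff)
  have C: "\<Phi> n f \<in> sym_C H (ad H M) n" by (rule \<Phi>_sym_C[OF fC])
  hence m: "\<Phi> n f \<in> maps (n + 1)" by (simp add: sym_C_iff)
  have "sym_sigma H n i (\<Phi> n f) = \<Phi> n f" if i: "1 \<le> i" "i \<le> n" for i
  proof -
    have "sym_sigma H n i (\<Phi> n f) = \<Phi> n (hoch_sigma H n i (\<Psi> n (\<Phi> n f)))"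
      using \<Psi>_sym_sigma[OF m i] \<Phi>_\<Psi> by metis
    thus ?thesis by (simp add: \<Psi>_\<Phi>_CS[OF f] fix_f[OF i])
  qed
  with C show ?thesis by (simp add: sym_CS_def sym_invariants_iff)
qed

lemma \<Phi>_hoch_delta:
  assumes f: "f \<in> hoch_CS H M n"
  shows "\<Phi> (n + 1) (hoch_delta H n f) = sym_delta H n (\<Phi> n f)"
    and "\<Psi> (n + 1) (\<Phi> (n + 1) (hoch_delta H n f)) = hoch_delta H n f"
proof -
  note d = \<Psi>_sym_delta[OF sym_CS_maps[OF \<Phi>_hoch_CS[OF f]], unfolded \<Psi>_\<Phi>_CS[OF f]]
  have m: "sym_delta H n (\<Phi> n f) \<in> maps (n + 1 + 1)"
    using d(1) by (simp add: One_nat_def)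
  show *: "\<Phi> (n + 1) (hoch_delta H n f) = sym_delta H n (\<Phi> n f)"
    using \<Phi>_\<Psi>[OF m] by (simp only: d(2))
  show "\<Psi> (n + 1) (\<Phi> (n + 1) (hoch_delta H n f)) = hoch_delta H n f"
    by (simp only: * d(2))
qed

lemma \<Phi>_image_CS: "\<Phi> n ` hoch_CS H M n = sym_CS H (ad H M) n"
proof
  show "\<Phi> n ` hoch_CS H M n \<subseteq> sym_CS H (ad H M) n"
    using \<Phi>_hoch_CS by blast
  show "sym_CS H (ad H M) n \<subseteq> \<Phi> n ` hoch_CS H M n"
    using \<Phi>_\<Psi>[OF sym_CS_maps] \<Psi>_sym_CS by (metis image_eqI subsetI)
qed

lemma \<Phi>_cocycles:
  "\<Phi> n ` {f \<in> hoch_CS H M n. hoch_delta H n f = 0} = {g \<in> sym_CS H (ad H M) n. sym_delta H n g = 0}"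
proof -
  have "hoch_delta H n f = 0 \<longleftrightarrow> sym_delta H n (\<Phi> n f) = 0" if "f \<in> hoch_CS H M n" for f
    using \<Phi>_hoch_delta[OF that] \<Phi>_zero \<Psi>_zero by metis
  thus ?thesis unfolding \<Phi>_image_CS[symmetric] by blast
qed

lemma \<Phi>_coboundaries:
  "\<Phi> (n + 1) ` hoch_delta H n ` hoch_CS H M n = sym_delta H n ` sym_CS H (ad H M) n"
  unfolding \<Phi>_image_CS[symmetric] image_image by (intro image_cong refl \<Phi>_hoch_delta(1))

lemma HHS_iso_HS: "HHS H M n \<cong>\<^sub>k HS H (ad H M) n"
  unfolding HHS_def HS_def cohomology_def mscale_ad
proof (rule quotient_space_isoI[where \<phi> = "\<Phi> n" and \<psi> = "\<Psi> n"])
  show "\<Phi> n ` (case n of 0 \<Rightarrow> {0} | Suc m \<Rightarrow> hoch_delta H m ` hoch_CS H M m)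
      = (case n of 0 \<Rightarrow> {0} | Suc m \<Rightarrow> sym_delta H m ` sym_CS H (ad H M) m)"
    using \<Phi>_coboundaries by (simp add: \<Phi>_zero One_nat_def split: nat.split)
  show "\<Psi> n (\<Phi> n x) = x" if "x \<in> (case n of 0 \<Rightarrow> {0} | Suc m \<Rightarrow> hoch_delta H m ` hoch_CS H M m)" for x
    using that \<Phi>_hoch_delta(2) by (auto simp: \<Phi>_zero \<Psi>_zero One_nat_def split: nat.splits)
qed (auto simp: \<Phi>_add \<Psi>_add \<Phi>_scale \<Phi>_cocycles \<Psi>_\<Phi>_CS)

end

theorem theorem4p5:
  fixes H :: "('k::field, 'a::ring_1) hopf"
    and M :: "('k, 'a, 'm::ab_group_add) bimodule"
    and n :: nat
  assumes "cocommutative_hopf_algebra H"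
    and "hopf_bimodule H M"
  shows "HHS H M n \<cong>\<^sub>k HS H (ad H M) n"
proof -
  interpret bimodule_cochains H M
    using assms by (rule bimodule_cochains.intro)
  show ?thesis by (rule HHS_iso_HS)
qed

end
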